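(* Let $G$ be a locally compact unimodular amenable topological group and let $T : G \curvearrowright X$ be a continuous action of $G$ on a compact metrizable space $X$. Let $\mu \in \mathcal{M}_T(X)$ be a $T$-invariant Borel probability measure on $X$. Let $(F_i)_{i \in \mathscr{I}}$ be a Følner net for $G$. Consider the conditions: (1) $T : G \curvearrowright X$ is uniquely ergodic. (2) For every net $(C_i)_{i \in \mathscr{I}}$ of Borel-measurable subsets of $X$ of positive $\mu$-measure, the net $\left( \alpha_{C_i}\left( \operatorname{Avg}_{F_i} f\right)\right)_{i \in \mathscr{I}}$ converges to $\int f \, \mathrm{d}\mu$ for all $f \in C(X)$. (3) For every net $(U_i)_{i \in \mathscr{I}}$ of open subsets of $X$ of positive $\mu$-measure, the net $\left( \alpha_{U_i}\left( \operatorname{Avg}_{F_i} f\right)\right)_{i \in \mathscr{I}}$ converges to $\int f \, \mathrm{d}\mu$ for all $f \in C(X)$. Then (1)$\Rightarrow$(2)$\Rightarrow$(3), and if $\mu$ is fully supported on $X$ (gives positive measure to every nonempty open set), then (3)$\Rightarrow$(1).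
   Context: $\mathcal{M}_T(X)$ denotes the set of $T$-invariant Borel probability measures on $X$; the action is uniquely ergodic if $\mathcal{M}_T(X)$ has exactly one element. $m$ is a bi-invariant Haar measure on $G$. For a compact $K \subseteq G$ with $m(K)>0$ and $f \in C(X)$, $\operatorname{Avg}_K f(x) = \frac{1}{m(K)} \int_K f(T_g x) \, \mathrm{d}m(g)$, a continuous function on $X$. For a measurable $C \subseteq X$ with $\mu(C)>0$, $\alpha_C(h) = \frac{1}{\mu(C)} \int_C h \, \mathrm{d}\mu$. A net $(F_i)_{i \in \mathscr{I}}$ of compact subsets of $G$ is Følner if $m(F_i)>0$ for all $i$ and $\lim_i \frac{m(gF_i \,\Delta\, F_i)}{m(F_i)} = 0$ for every $g \in G$. The action convention is $T_{gh} = T_g T_h$. *)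

theory Defs
  imports "HOL-Analysis.Analysis" "HOL-Probability.Probability_Measure"
begin

text \<open>
  Groups are written additively, since the library's class of (not necessarily commutative)
  topological groups is \<^class>\<open>topological_group_add\<close>: \<open>g + h\<close> stands for the product \<open>gh\<close>
  and \<open>0\<close> for the identity element.
\<close>

section \<open>Nets\<close>

text \<open>
  A net is a family indexed by a directed preorder. The library's filter \<^const>\<open>at_top\<close> is only
  available for partial orders, hence the separate filter of tails.
\<close>

class directed_preorder = preorder +
  assumes directed: "\<exists>k. i \<le> k \<and> j \<le> k"

definition net_filter :: "'i::directed_preorder filter" where
  "net_filter = (INF i. principal {i..})"

lemma eventually_net_filter:
  "eventually P (net_filter :: 'i::directed_preorder filter) \<longleftrightarrow> (\<exists>i. \<forall>j\<ge>i. P j)"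
  unfolding net_filter_def
proof (subst eventually_INF_base)
  show "\<exists>k\<in>UNIV. principal {k..} \<le> inf (principal {i..}) (principal {j..})"
    for i j :: 'i
  proof -
    obtain k where k: "i \<le> k" "j \<le> k"
      using directed by blast
    then have "{k..} \<subseteq> {i..} \<inter> {j..}"
      by (auto intro: order_trans)
    then show ?thesis
      by auto
  qed
qed (auto simp: eventually_principal)


section \<open>Haar measures, unimodularity, amenability\<close>

definition radon_measure :: "'a::topological_space measure \<Rightarrow> bool" where
  "radon_measure m \<longleftrightarrow>
     sets m = sets borel \<and>
     (\<forall>K. compact K \<longrightarrow> emeasure m K < \<infinity>) \<and>
     (\<forall>A\<in>sets borel. emeasure m A = (INF U\<in>{U. open U \<and> A \<subseteq> U}. emeasure m U)) \<and>
     (\<forall>U. open U \<longrightarrow> emeasure m U = (SUP K\<in>{K. compact K \<and> K \<subseteq> U}. emeasure m K))"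

definition left_haar_measure :: "'g::topological_group_add measure \<Rightarrow> bool" where
  "left_haar_measure m \<longleftrightarrow>
     radon_measure m \<and> emeasure m UNIV \<noteq> 0 \<and> (\<forall>g. distr m borel (\<lambda>x. g + x) = m)"

definition bi_invariant_haar_measure :: "'g::topological_group_add measure \<Rightarrow> bool" where
  "bi_invariant_haar_measure m \<longleftrightarrow>
     left_haar_measure m \<and> (\<forall>g. distr m borel (\<lambda>x. x + g) = m)"

definition unimodular_group :: "'g::topological_group_add itself \<Rightarrow> bool" where
  "unimodular_group _ \<longleftrightarrow>
     (\<forall>m :: 'g measure. left_haar_measure m \<longrightarrow> bi_invariant_haar_measure m)"

definition left_translate ::
  "'g::topological_group_add \<Rightarrow> ('g \<Rightarrow>\<^sub>C real) \<Rightarrow> ('g \<Rightarrow>\<^sub>C real)" where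
  "left_translate g f = Bcontfun (\<lambda>x. apply_bcontfun f (g + x))"

lemma apply_left_translate [simp]:
  "apply_bcontfun (left_translate g f) x = apply_bcontfun f (g + x)"
proof -
  have "continuous_on UNIV (\<lambda>x. apply_bcontfun f (g + x))"
  proof (rule continuous_on_compose2[of UNIV "apply_bcontfun f"])
    show "continuous_on UNIV (\<lambda>x. g + x)"
      unfolding continuous_on_def by (intro ballI tendsto_add tendsto_const tendsto_ident_at)
  qed auto
  moreover have "range (\<lambda>x. apply_bcontfun f (g + x)) \<subseteq> range (apply_bcontfun f)"
    by auto
  then have "bounded (range (\<lambda>x. apply_bcontfun f (g + x)))"
    by (rule bounded_subset[OF bounded_apply_bcontfun])
  ultimately have "(\<lambda>x. apply_bcontfun f (g + x)) \<in> bcontfun"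
    by (simp add: bcontfun_def)
  then show ?thesis
    by (simp add: left_translate_def Bcontfun_inverse)
qed

text \<open>Amenability: there is a left-invariant mean on the bounded continuous functions.\<close>

definition amenable_group :: "'g::topological_group_add itself \<Rightarrow> bool" where
  "amenable_group _ \<longleftrightarrow>
     (\<exists>\<Lambda> :: ('g \<Rightarrow>\<^sub>C real) \<Rightarrow> real.
        linear \<Lambda> \<and>
        (\<forall>f. (\<forall>x. 0 \<le> apply_bcontfun f x) \<longrightarrow> 0 \<le> \<Lambda> f) \<and>
        \<Lambda> (const_bcontfun 1) = 1 \<and>
        (\<forall>g f. \<Lambda> (left_translate g f) = \<Lambda> f))"

definition folner_net ::
  "'g::topological_group_add measure \<Rightarrow> ('i::directed_preorder \<Rightarrow> 'g set) \<Rightarrow> bool" where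
  "folner_net m F \<longleftrightarrow>
     (\<forall>i. compact (F i) \<and> measure m (F i) > 0) \<and>
     (\<forall>g. ((\<lambda>i. measure m (sym_diff ((\<lambda>x. g + x) ` F i) (F i)) / measure m (F i))
             \<longlongrightarrow> 0) net_filter)"


section \<open>Actions, invariant measures, averages\<close>

definition continuous_action ::
  "('g::topological_group_add \<Rightarrow> 'x::topological_space \<Rightarrow> 'x) \<Rightarrow> bool" where
  "continuous_action T \<longleftrightarrow>
     T 0 = id \<and> (\<forall>g h. T (g + h) = T g \<circ> T h) \<and> continuous_on UNIV (\<lambda>(g, x). T g x)"

definition invariant_prob_measures ::
  "('g \<Rightarrow> 'x::topological_space \<Rightarrow> 'x) \<Rightarrow> 'x measure set" where
  "invariant_prob_measures T =
     {\<mu>. prob_space \<mu> \<and> sets \<mu> = sets borel \<and> (\<forall>g. distr \<mu> borel (T g) = \<mu>)}"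

definition uniquely_ergodic :: "('g \<Rightarrow> 'x::topological_space \<Rightarrow> 'x) \<Rightarrow> bool" where
  "uniquely_ergodic T \<longleftrightarrow> (\<exists>!\<mu>. \<mu> \<in> invariant_prob_measures T)"

definition fully_supported :: "'x::topological_space measure \<Rightarrow> bool" where
  "fully_supported \<mu> \<longleftrightarrow> (\<forall>U. open U \<and> U \<noteq> {} \<longrightarrow> measure \<mu> U > 0)"

definition Avg ::
  "'g measure \<Rightarrow> ('g \<Rightarrow> 'x \<Rightarrow> 'x) \<Rightarrow> 'g set \<Rightarrow> ('x \<Rightarrow> complex) \<Rightarrow> 'x \<Rightarrow> complex" where
  "Avg m T K f x = (LINT g:K|m. f (T g x)) /\<^sub>R measure m K"

definition mean_on :: "'x measure \<Rightarrow> 'x set \<Rightarrow> ('x \<Rightarrow> complex) \<Rightarrow> complex" where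
  "mean_on \<mu> C h = (LINT x:C|\<mu>. h x) /\<^sub>R measure \<mu> C"

text \<open>
  For every net \<open>(C\<^sub>i)\<close> of sets from \<open>\<S>\<close> of positive measure (over the same directed set as
  \<open>(F\<^sub>i)\<close>) and every continuous \<open>f\<close>, the means over \<open>C\<^sub>i\<close> of the averages over \<open>F\<^sub>i\<close> converge to
  \<open>\<integral>f d\<mu>\<close>.
\<close>

definition means_of_averages_converge ::
  "'x set set \<Rightarrow> 'g measure \<Rightarrow> ('g \<Rightarrow> 'x \<Rightarrow> 'x) \<Rightarrow> 'x::topological_space measure \<Rightarrow>
   ('i::directed_preorder \<Rightarrow> 'g set) \<Rightarrow> bool" where
  "means_of_averages_converge \<S> m T \<mu> F \<longleftrightarrow>
     (\<forall>C. (\<forall>i. C i \<in> \<S> \<and> measure \<mu> (C i) > 0) \<longrightarrow>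
       (\<forall>f. continuous_on UNIV f \<longrightarrow>
         ((\<lambda>i. mean_on \<mu> (C i) (Avg m T (F i) f)) \<longlongrightarrow> (LINT x|\<mu>. f x)) net_filter))"

end

theory Submission
  imports Defs
begin

text \<open>
  (1) \<open>\<Rightarrow>\<close> (2): the averages of \<open>u\<close> over \<open>F i\<close> converge to \<open>\<integral>u d\<mu>\<close> uniformly on the space. Otherwise
  there are points \<open>x i\<close> at which they stay away from \<open>\<integral>u d\<mu>\<close> along a subnet; by Tychonoff's theorem
  the functionals \<open>u \<mapsto> Avg (F i) u (x i)\<close> have a cluster point there, which is positive, normalised and,
  by the Folner condition, invariant. The Riesz representation theorem turns it into an invariant
  probability measure different from \<open>\<mu>\<close>.

  (3) \<open>\<Rightarrow>\<close> (1): let \<open>\<nu>\<close> be invariant and \<open>e > 0\<close>. Every average of \<open>u\<close> has \<open>\<nu>\<close>-integral \<open>\<integral>u d\<nu>\<close>, so it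
  exceeds \<open>\<integral>u d\<nu> - e\<close> on a nonempty open set, which has positive \<open>\<mu>\<close>-measure. The means over these
  open sets converge to \<open>\<integral>u d\<mu>\<close>, whence \<open>\<integral>u d\<nu> - e \<le> \<integral>u d\<mu>\<close>. Apply this to \<open>u\<close> and \<open>-u\<close>.
\<close>


section \<open>The Riesz representation theorem on a compact metrizable space\<close>

text \<open>The function is the distance to the complement of \<open>U\<close>, for a metric
  inducing the topology. The case \<open>U = UNIV\<close> is separate, since there the infimum would
  range over the empty set.\<close>

lemma metrizable_cozero:
  fixes U :: "'x::topological_space set"
  assumes "metrizable_space (euclidean :: 'x topology)" and "open U"
  obtains d :: "'x \<Rightarrow> real"
  where "continuous_on UNIV d" "\<And>x. 0 \<le> d x" "\<And>x. 0 < d x \<longleftrightarrow> x \<in> U"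
proof (cases "U = UNIV")
  case True
  show ?thesis
    by (rule that[of "\<lambda>_. 1"]) (use True in auto)
next
  case False
  obtain M \<rho> where M: "Metric_space M \<rho>" and top: "(euclidean :: 'x topology) = Metric_space.mtopology M \<rho>"
    using assms(1) unfolding metrizable_space_def by blast
  have "M = UNIV"
    using arg_cong[OF top, of topspace] Metric_space.topspace_mtopology[OF M] by simp
  then interpret Metric_space UNIV \<rho>
    using M by simp
  note top = top[unfolded \<open>M = UNIV\<close>]
  have openI: "open S \<longleftrightarrow> (\<forall>x\<in>S. \<exists>r>0. mball x r \<subseteq> S)" for S
    using openin_mtopology[of S] unfolding top[symmetric] by auto
  define D where "D x = (INF y\<in>-U. \<rho> x y)" for x
  have bdd: "bdd_below (\<rho> x ` (-U))" for x
    by (rule bdd_belowI[of _ 0]) auto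
  have ne: "- U \<noteq> {}"
    using False by auto
  \<comment> \<open>\<open>D\<close> is 1-Lipschitz, from which continuity follows.\<close>
  have le: "D x \<le> \<rho> x y + D y" for x y
  proof -
    have "D x - \<rho> x y \<le> D y"
      unfolding D_def[of y]
    proof (rule cINF_greatest[OF ne])
      fix z assume "z \<in> - U"
      then have "D x \<le> \<rho> x z"
        unfolding D_def by (rule cINF_lower[OF bdd])
      also have "\<dots> \<le> \<rho> x y + \<rho> y z"
        by (rule triangle) auto
      finally show "D x - \<rho> x y \<le> \<rho> y z" by simp
    qed
    then show ?thesis by simp
  qed
  have "continuous_on UNIV D"
    unfolding continuous_on_def
  proof
    fix x
    show "(D \<longlongrightarrow> D x) (at x)"
    proof (rule tendstoI)
      fix e :: real assume "0 < e"
      have "open (mball x e)"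
        using openin_mball[of x e] unfolding top[symmetric] by auto
      moreover have "dist (D y) (D x) < e" if "y \<in> mball x e" for y
        using that le[of x y] le[of y x] commute[of x y] by (auto simp: dist_real_def)
      ultimately show "\<forall>\<^sub>F y in at x. dist (D y) (D x) < e"
        using \<open>0 < e\<close> unfolding eventually_at_topological
        by (intro exI[of _ "mball x e"]) auto
    qed
  qed
  moreover have "0 \<le> D x" for x
    unfolding D_def by (rule cINF_greatest[OF ne]) auto
  moreover have "0 < D x \<longleftrightarrow> x \<in> U" for x
  proof
    assume "x \<in> U"
    then obtain r where r: "r > 0" "mball x r \<subseteq> U"
      using \<open>open U\<close> openI by blast
    have "r \<le> D x"
      unfolding D_def
    proof (rule cINF_greatest[OF ne])
      fix y assume "y \<in> - U"
      then show "r \<le> \<rho> x y"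
        using r(2) by (auto simp: subset_eq not_less[symmetric])
    qed
    with r show "0 < D x" by simp
  next
    assume "0 < D x"
    show "x \<in> U"
    proof (rule ccontr)
      assume "x \<notin> U"
      then have "D x \<le> \<rho> x x"
        unfolding D_def by (intro cINF_lower[OF bdd]) auto
      with \<open>0 < D x\<close> show False by simp
    qed
  qed
  ultimately show ?thesis
    by (rule that)
qed

text \<open>With \<open>d\<close> from \<open>metrizable_cozero\<close>, the functions are
  \<open>min 1 (n * d)\<close>. At each point of \<open>U\<close> they reach the value 1 at a finite
  stage, which is stronger than convergence and feeds the compactness argument in
  \<open>content_UN_le\<close>.\<close>

lemma open_approx_continuous:
  fixes U :: "'x::topological_space set"
  assumes "metrizable_space (euclidean :: 'x topology)" and "open U"
  obtains \<phi> :: "nat \<Rightarrow> 'x \<Rightarrow> real"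
  where "\<And>n. continuous_on UNIV (\<phi> n)" "\<And>n x. 0 \<le> \<phi> n x" "\<And>n x. \<phi> n x \<le> 1"
    "\<And>n x. x \<notin> U \<Longrightarrow> \<phi> n x = 0" "incseq \<phi>" "\<And>x. x \<in> U \<Longrightarrow> \<forall>\<^sub>F n in sequentially. \<phi> n x = 1"
    "\<And>x. (\<lambda>n. \<phi> n x) \<longlonglongrightarrow> indicator U x"
proof -
  obtain d :: "'x \<Rightarrow> real" where d: "continuous_on UNIV d" "\<And>x. 0 \<le> d x" "\<And>x. 0 < d x \<longleftrightarrow> x \<in> U"
    using metrizable_cozero[OF assms] by blast
  define \<phi> where "\<phi> n x = min 1 (real n * d x)" for n x
  have ev: "\<forall>\<^sub>F n in sequentially. \<phi> n x = 1" if "x \<in> U" for x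
  proof -
    have "0 < d x"
      using that d(3) by blast
    then obtain N where N: "1 < real N * d x"
      using reals_Archimedean3 by blast
    have "1 \<le> real n * d x" if "N \<le> n" for n
      using N mult_right_mono[of "real N" "real n" "d x"] that d(2)[of x] by linarith
    then show ?thesis
      unfolding eventually_sequentially \<phi>_def by (intro exI[of _ N]) auto
  qed
  have zero: "\<phi> n x = 0" if "x \<notin> U" for n x
    using that d(2)[of x] d(3)[of x] by (auto simp: \<phi>_def)
  have lim: "(\<lambda>n. \<phi> n x) \<longlonglongrightarrow> indicator U x" for x
    by (cases "x \<in> U") (auto simp: zero intro!: tendsto_eventually ev)
  show ?thesis
  proof (rule that[of \<phi>, OF _ _ _ zero _ ev lim])
    show "continuous_on UNIV (\<phi> n)" for n
      unfolding \<phi>_def by (intro continuous_intros d)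
    show "incseq \<phi>"
      unfolding incseq_def \<phi>_def le_fun_def
      by (intro allI impI min.mono mult_right_mono d order_refl) auto
  qed (auto simp: \<phi>_def d)
qed

section \<open>Positive normalised functionals on continuous functions\<close>

text \<open>\<open>\<Lambda>\<close> is a total function, but the axioms constrain it only on
  continuous arguments; its values elsewhere are arbitrary.\<close>

locale probability_functional =
  fixes \<Lambda> :: "('x::topological_space \<Rightarrow> real) \<Rightarrow> real"
  assumes compact_space: "compact (UNIV :: 'x set)"
    and metrizable: "metrizable_space (euclidean :: 'x topology)"
    and add: "\<And>u v. continuous_on UNIV u \<Longrightarrow> continuous_on UNIV v \<Longrightarrow>
      \<Lambda> (\<lambda>x. u x + v x) = \<Lambda> u + \<Lambda> v"
    and scale: "\<And>c u. continuous_on UNIV u \<Longrightarrow> \<Lambda> (\<lambda>x. c * u x) = c * \<Lambda> u"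
    and nonneg: "\<And>u. continuous_on UNIV u \<Longrightarrow> (\<And>x. 0 \<le> u x) \<Longrightarrow> 0 \<le> \<Lambda> u"
    and one: "\<Lambda> (\<lambda>_. 1) = 1"
begin

lemma const: "\<Lambda> (\<lambda>_. c) = c"
  using scale[of "\<lambda>_. 1" c] one by simp

lemma diff:
  assumes "continuous_on UNIV u" "continuous_on UNIV v"
  shows "\<Lambda> (\<lambda>x. u x - v x) = \<Lambda> u - \<Lambda> v"
  using add[of u "\<lambda>x. - 1 * v x"] scale[of v "-1"] assms by (simp add: continuous_on_minus)

lemma mono:
  assumes "continuous_on UNIV u" "continuous_on UNIV v" "\<And>x. u x \<le> v x"
  shows "\<Lambda> u \<le> \<Lambda> v"
  using nonneg[of "\<lambda>x. v x - u x"] diff[of v u] assms by (simp add: continuous_on_diff)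

lemma sum:
  assumes "finite I" "\<And>i. i \<in> I \<Longrightarrow> continuous_on UNIV (u i)"
  shows "\<Lambda> (\<lambda>x. \<Sum>i\<in>I. u i x) = (\<Sum>i\<in>I. \<Lambda> (u i))"
  using assms by (induction I rule: finite_induct) (simp_all add: const add continuous_on_sum)

section \<open>The outer measure induced by the functional\<close>

text \<open>Functions only have to vanish off \<open>U\<close>; their closed support may leave
  \<open>U\<close>. The error \<open>e\<close> allowed in \<open>content_UN_le\<close> and
  \<open>content_split\<close> compensates for this.\<close>

definition below :: "'x set \<Rightarrow> ('x \<Rightarrow> real) set" where
  "below U = {u. continuous_on UNIV u \<and> (\<forall>x. 0 \<le> u x \<and> u x \<le> 1) \<and> (\<forall>x. x \<notin> U \<longrightarrow> u x = 0)}"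

definition content :: "'x set \<Rightarrow> ennreal" where
  "content U = (SUP u\<in>below U. ennreal (\<Lambda> u))"

definition outer :: "'x set \<Rightarrow> ennreal" where
  "outer A = (INF U\<in>{U. open U \<and> A \<subseteq> U}. content U)"

lemma below_nonempty: "below U \<noteq> {}"
proof -
  have "(\<lambda>_. 0) \<in> below U"
    by (auto simp: below_def)
  then show ?thesis
    by blast
qed

lemma content_upper: "u \<in> below U \<Longrightarrow> ennreal (\<Lambda> u) \<le> content U"
  unfolding content_def by (rule SUP_upper)

lemma content_mono: "U \<subseteq> V \<Longrightarrow> content U \<le> content V"
  unfolding content_def by (rule SUP_subset_mono) (auto simp: below_def)

lemma outer_le: "open U \<Longrightarrow> A \<subseteq> U \<Longrightarrow> outer A \<le> content U"
  unfolding outer_def by (rule INF_lower) auto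

lemma outer_open: "open U \<Longrightarrow> outer U = content U"
  unfolding outer_def by (rule antisym[OF INF_lower INF_greatest]) (auto intro: content_mono)

lemma outer_mono: "A \<subseteq> B \<Longrightarrow> outer A \<le> outer B"
  unfolding outer_def by (rule INF_superset_mono) auto

lemma content_UNIV: "content UNIV = 1"
proof (rule antisym)
  show "content UNIV \<le> 1"
    unfolding content_def
    by (rule SUP_least) (use mono[of _ "\<lambda>_. 1"] one in \<open>auto simp: below_def\<close>)
  show "1 \<le> content UNIV"
    using content_upper[of "\<lambda>_. 1" UNIV] one by (simp add: below_def)
qed

lemma outer_empty: "outer {} = 0"
proof -
  have "below {} = {\<lambda>_. 0}"
    by (auto simp: below_def)
  then show ?thesis
    by (simp add: outer_open content_def const)
qed

lemma outer_le_1: "outer A \<le> 1"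
  using outer_le[of UNIV A] content_UNIV by simp

text \<open>Up to \<open>e\<close>, a function below the union is dominated by a finite sum of
  functions below the single \<open>U n\<close>: pointwise this is clear, and compactness of the
  space makes it uniform.\<close>

lemma content_UN_le:
  fixes U :: "nat \<Rightarrow> 'x set"
  assumes "\<And>n. open (U n)"
  shows "content (\<Union>n. U n) \<le> (\<Sum>n. content (U n))"
  unfolding content_def[of "\<Union>n. U n"]
proof (rule SUP_least)
  fix u assume "u \<in> below (\<Union>n. U n)"
  then have u: "continuous_on UNIV u" "\<And>x. 0 \<le> u x" "\<And>x. u x \<le> 1" "\<And>x. x \<notin> (\<Union>n. U n) \<Longrightarrow> u x = 0"
    by (auto simp: below_def)
  have "\<forall>n. \<exists>\<phi> :: nat \<Rightarrow> 'x \<Rightarrow> real. (\<forall>j. \<phi> j \<in> below (U n)) \<and> incseq \<phi> \<and>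
      (\<forall>x\<in>U n. \<exists>j. \<phi> j x = 1)"
  proof
    fix n
    obtain \<phi> :: "nat \<Rightarrow> 'x \<Rightarrow> real"
      where \<phi>: "\<And>j. continuous_on UNIV (\<phi> j)" "\<And>j x. 0 \<le> \<phi> j x" "\<And>j x. \<phi> j x \<le> 1"
        "\<And>j x. x \<notin> U n \<Longrightarrow> \<phi> j x = 0" "incseq \<phi>"
        "\<And>x. x \<in> U n \<Longrightarrow> \<forall>\<^sub>F j in sequentially. \<phi> j x = 1"
        "\<And>x. (\<lambda>j. \<phi> j x) \<longlonglongrightarrow> indicator (U n) x"
      using open_approx_continuous[OF metrizable assms[of n]] by blast
    have "\<exists>j. \<phi> j x = 1" if "x \<in> U n" for x
      using eventually_happens[OF \<phi>(6)[OF that]] by simp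
    with \<phi> show "\<exists>\<phi> :: nat \<Rightarrow> 'x \<Rightarrow> real. (\<forall>j. \<phi> j \<in> below (U n)) \<and> incseq \<phi> \<and>
      (\<forall>x\<in>U n. \<exists>j. \<phi> j x = 1)"
      by (auto simp: below_def intro!: exI[of _ \<phi>])
  qed
  then obtain \<phi> :: "nat \<Rightarrow> nat \<Rightarrow> 'x \<Rightarrow> real"
    where \<phi>: "\<And>n j. \<phi> n j \<in> below (U n)" "\<And>n. incseq (\<phi> n)"
      "\<And>n x. x \<in> U n \<Longrightarrow> \<exists>j. \<phi> n j x = 1"
    by metis
  have cont: "continuous_on UNIV (\<phi> n j)" and nn: "0 \<le> \<phi> n j x" for n j x
    using \<phi>(1)[of n j] by (auto simp: below_def)
  \<comment> \<open>One index serves both as the number of summands and as the stage of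
    approximation, so \<open>s\<close> is increasing in \<open>N\<close> and a finite subcover
    reduces to an upper bound of its indices.\<close>
  define s where "s N x = (\<Sum>n<N. \<phi> n N x)" for N x
  have cs: "continuous_on UNIV (s N)" for N
    unfolding s_def by (intro continuous_intros cont)
  have s_mono: "s N x \<le> s N' x" if "N \<le> N'" for N N' x
  proof -
    have "s N x \<le> (\<Sum>n<N. \<phi> n N' x)"
      unfolding s_def by (intro sum_mono) (use \<phi>(2) that in \<open>auto simp: incseq_def le_fun_def\<close>)
    also have "\<dots> \<le> s N' x"
      unfolding s_def by (rule sum_mono2) (use that nn in auto)
    finally show ?thesis .
  qed
  show "ennreal (\<Lambda> u) \<le> (\<Sum>n. content (U n))"
  proof (rule ennreal_le_epsilon)
    fix e :: real assume e: "0 < e"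
    have "UNIV \<subseteq> (\<Union>N. {x. u x < s N x + e})"
    proof
      fix x :: 'x
      show "x \<in> (\<Union>N. {x. u x < s N x + e})"
      proof (cases "u x = 0")
        case True
        then show ?thesis
          using e by (auto simp: s_def intro!: exI[of _ 0])
      next
        case False
        then obtain n where "x \<in> U n"
          using u(4) by blast
        then obtain j where j: "\<phi> n j x = 1"
          using \<phi>(3) by blast
        \<comment> \<open>\<open>Suc n\<close> puts the summand \<open>n\<close> into the sum, and
          \<open>j\<close> makes this summand equal to 1 at \<open>x\<close>.\<close>
        let ?N = "max (Suc n) j"
        have "1 \<le> \<phi> n ?N x"
          using \<phi>(2)[of n] j unfolding incseq_def le_fun_def by (metis max.cobounded2)
        also have "\<dots> \<le> s ?N x"
          unfolding s_def by (rule member_le_sum) (auto simp: nn)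
        finally have "u x < s ?N x + e"
          using u(3)[of x] e by linarith
        then show ?thesis
          by blast
      qed
    qed
    moreover have "open {x. u x < s N x + e}" for N
      by (intro open_Collect_less continuous_intros cs u)
    ultimately obtain I where I: "finite I" "UNIV \<subseteq> (\<Union>N\<in>I. {x. u x < s N x + e})"
      using compactE_image[OF compact_space, of UNIV "\<lambda>N. {x. u x < s N x + e}"] by metis
    obtain N where N: "\<And>n. n \<in> I \<Longrightarrow> n \<le> N"
      using I(1) unfolding finite_nat_set_iff_bounded_le by auto
    have le: "u x \<le> s N x + e" for x
    proof -
      obtain n where "n \<in> I" "u x < s n x + e"
        using I(2) by blast
      then show ?thesis
        using s_mono[of n N x] N[of n] by linarith
    qed
    have "\<Lambda> u \<le> \<Lambda> (\<lambda>x. s N x + e)"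
      by (intro mono le u continuous_intros cs)
    also have "\<dots> = \<Lambda> (s N) + e"
      using add[OF cs[of N] continuous_on_const[of _ e]] const[of e] by simp
    also have "\<Lambda> (s N) = (\<Sum>n<N. \<Lambda> (\<phi> n N))"
      unfolding s_def by (rule sum) (auto intro: cont)
    finally have "ennreal (\<Lambda> u) \<le> ennreal ((\<Sum>n<N. \<Lambda> (\<phi> n N)) + e)"
      by (rule ennreal_leI)
    also have "\<dots> = (\<Sum>n<N. ennreal (\<Lambda> (\<phi> n N))) + ennreal e"
      using e nonneg[OF cont nn] by (subst ennreal_plus) (auto intro!: sum_nonneg simp: sum_ennreal)
    also have "\<dots> \<le> (\<Sum>n<N. content (U n)) + ennreal e"
      by (intro add_mono sum_mono content_upper \<phi> order_refl)
    also have "\<dots> \<le> (\<Sum>n. content (U n)) + ennreal e"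
      by (intro add_mono sum_le_suminf order_refl) auto
    finally show "ennreal (\<Lambda> u) \<le> (\<Sum>n. content (U n)) + ennreal e" .
  qed
qed

lemma outer_measure_space_outer: "outer_measure_space (Pow UNIV) outer"
  unfolding outer_measure_space_def
proof (intro conjI)
  show "positive (Pow UNIV) outer"
    by (simp add: positive_def outer_empty)
  show "increasing (Pow UNIV) outer"
    by (simp add: increasing_def outer_mono)
  show "countably_subadditive (Pow UNIV) outer"
    unfolding countably_subadditive_def
  proof (intro allI impI)
    fix A :: "nat \<Rightarrow> 'x set"
    show "outer (\<Union>n. A n) \<le> (\<Sum>n. outer (A n))"
    proof (rule ennreal_le_epsilon)
      fix e :: real assume "0 < e"
      \<comment> \<open>The errors \<open>e * (1/2) ^ Suc n\<close> add up to \<open>e\<close>.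
        Finiteness of \<open>outer (A n)\<close> gives the strict inequality that yields a witness
        for the infimum.\<close>
      have "\<exists>U. open U \<and> A n \<subseteq> U \<and> content U \<le> outer (A n) + e * (1/2) ^ Suc n" for n
      proof -
        have "outer (A n) < top"
          using outer_le_1[of "A n"] by (rule le_less_trans) simp
        then have "outer (A n) < outer (A n) + e * (1/2) ^ Suc n"
          using \<open>0 < e\<close> by (auto simp: less_top)
        then have "\<exists>U\<in>{U. open U \<and> A n \<subseteq> U}. content U < outer (A n) + e * (1/2) ^ Suc n"
          by (subst (asm) (1) outer_def) (simp only: INF_less_iff)
        then show ?thesis
          by (auto intro: less_imp_le)
      qed
      then obtain U where U: "\<And>n. open (U n)" "\<And>n. A n \<subseteq> U n"
          "\<And>n. content (U n) \<le> outer (A n) + e * (1/2) ^ Suc n"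
        by metis
      have "outer (\<Union>n. A n) \<le> content (\<Union>n. U n)"
        by (rule outer_le) (use U in blast)+
      also have "\<dots> \<le> (\<Sum>n. content (U n))"
        by (rule content_UN_le[OF U(1)])
      also have "\<dots> \<le> (\<Sum>n. outer (A n) + e * (1/2) ^ Suc n)"
        by (intro suminf_le U) auto
      also have "\<dots> = (\<Sum>n. outer (A n)) + (\<Sum>n. ennreal e * ennreal ((1/2) ^ Suc n))"
        using \<open>0 < e\<close>
        by (subst suminf_add[symmetric])
          (auto simp del: ennreal_suminf_cmult simp add: ennreal_mult[symmetric])
      also have "\<dots> = (\<Sum>n. outer (A n)) + e"
        unfolding ennreal_suminf_cmult
        by (subst suminf_ennreal_eq[OF zero_le_power power_half_series]) auto
      finally show "outer (\<Union>n. A n) \<le> (\<Sum>n. outer (A n)) + ennreal e" .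
    qed
  qed
qed

lemma outer_subadditive: "A \<inter> B = {} \<Longrightarrow> outer (A \<union> B) \<le> outer A + outer B"
  using ring_of_sets.countably_subadditive_subadditive[OF ring_of_sets_Pow, of UNIV outer]
    outer_measure_space_outer
  by (auto simp: outer_measure_space_def subadditive_def)

text \<open>Truncating \<open>u\<close> at height \<open>e\<close> leaves a function that vanishes off the closed set \<open>{u \<ge> e}\<close>, so
  it can be added to any function below the complement of that set.\<close>

lemma content_split:
  assumes U: "open U" and V: "open V"
  shows "content (U \<inter> V) + outer (U - V) \<le> content U"
proof -
  have *: "ennreal (\<Lambda> u) + outer (U - V) \<le> content U" if "u \<in> below (U \<inter> V)" for u
  proof (rule ennreal_le_epsilon)
    fix e :: real assume e: "0 < e"
    have u: "continuous_on UNIV u" "\<And>x. 0 \<le> u x" "\<And>x. u x \<le> 1" "\<And>x. x \<notin> U \<inter> V \<Longrightarrow> u x = 0"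
      using that by (auto simp: below_def)
    define W where "W = U \<inter> {x. u x < e}"
    define w where "w x = max 0 (u x - e)" for x
    have w: "continuous_on UNIV w"
      unfolding w_def by (intro continuous_intros u)
    have "\<Lambda> u \<le> \<Lambda> (\<lambda>x. w x + e)"
      by (intro mono u continuous_intros w) (auto simp: w_def)
    also have "\<dots> = \<Lambda> w + e"
      using add[OF w, of "\<lambda>_. e"] const by simp
    finally have uw: "\<Lambda> u \<le> \<Lambda> w + e" .
    have "open {x. u x < e}"
      by (intro open_Collect_less continuous_intros u)
    then have "outer (U - V) \<le> content W"
      unfolding W_def by (intro outer_le) (use U u(4) e in auto)
    moreover have "ennreal (\<Lambda> u) + ennreal (\<Lambda> v) \<le> content U + ennreal e" if "v \<in> below W" for v
    proof -
      have v: "continuous_on UNIV v" "\<And>x. 0 \<le> v x" "\<And>x. v x \<le> 1" "\<And>x. x \<notin> W \<Longrightarrow> v x = 0"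
        using that by (auto simp: below_def)
      have "w x + v x \<le> 1" for x
        using u(3)[of x] v(3)[of x] v(4)[of x] e by (cases "x \<in> W") (auto simp: W_def w_def)
      then have "(\<lambda>x. w x + v x) \<in> below U"
        using u(4) v e
        by (auto simp: below_def W_def w_def intro!: continuous_intros w[unfolded w_def[abs_def]])
      then have "ennreal (\<Lambda> (\<lambda>x. w x + v x)) \<le> content U"
        by (rule content_upper)
      then have "ennreal (\<Lambda> (\<lambda>x. w x + v x)) + ennreal e \<le> content U + ennreal e"
        by (rule add_right_mono)
      moreover have "\<Lambda> u + \<Lambda> v \<le> \<Lambda> (\<lambda>x. w x + v x) + e"
        using add[OF w v(1)] uw by simp
      moreover have "0 \<le> \<Lambda> u" "0 \<le> \<Lambda> v" "0 \<le> \<Lambda> (\<lambda>x. w x + v x)"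
        using nonneg[OF u(1,2)] nonneg[OF v(1,2)] nonneg[OF continuous_on_add[OF w v(1)]] v(2)
        by (auto simp: w_def)
      ultimately show ?thesis
        using e by (simp add: ennreal_plus[symmetric] del: ennreal_plus) (meson ennreal_leI order_trans)
    qed
    then have "ennreal (\<Lambda> u) + content W \<le> content U + ennreal e"
      unfolding content_def[of W]
      by (subst ennreal_SUP_add_right) (auto intro!: SUP_least simp: below_nonempty)
    ultimately show "ennreal (\<Lambda> u) + outer (U - V) \<le> content U + ennreal e"
      by (meson add_left_mono order_trans)
  qed
  then show ?thesis
    unfolding content_def[of "U \<inter> V"]
    by (subst ennreal_SUP_add_left[symmetric]) (auto intro!: SUP_least simp: below_nonempty)
qed

section \<open>Caratheodory's extension to the Borel sets\<close>

text \<open>Since \<open>outer A\<close> is an infimum over open supersets \<open>U\<close> of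
  \<open>A\<close>, Caratheodory's criterion reduces to splitting such a \<open>U\<close> along
  \<open>V\<close>, which is \<open>content_split\<close>.\<close>

lemma open_in_lambda_system:
  assumes V: "open V"
  shows "V \<in> lambda_system UNIV (Pow UNIV) outer"
proof -
  have "outer (V \<inter> A) + outer ((UNIV - V) \<inter> A) = outer A" for A
  proof (rule antisym)
    show "outer (V \<inter> A) + outer ((UNIV - V) \<inter> A) \<le> outer A"
      unfolding outer_def[of A]
    proof (rule INF_greatest, clarify)
      fix U :: "'x set" assume U: "open U" "A \<subseteq> U"
      have "outer (V \<inter> A) + outer ((UNIV - V) \<inter> A) \<le> content (U \<inter> V) + outer (U - V)"
        by (intro add_mono outer_le outer_mono) (use U V in auto)
      also have "\<dots> \<le> content U"
        by (rule content_split[OF U(1) V])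
      finally show "outer (V \<inter> A) + outer ((UNIV - V) \<inter> A) \<le> content U" .
    qed
    have "outer A = outer ((V \<inter> A) \<union> ((UNIV - V) \<inter> A))"
      by (rule arg_cong[of _ _ outer]) auto
    also have "\<dots> \<le> outer (V \<inter> A) + outer ((UNIV - V) \<inter> A)"
      by (rule outer_subadditive) auto
    finally show "outer A \<le> outer (V \<inter> A) + outer ((UNIV - V) \<inter> A)" .
  qed
  then show ?thesis
    by (simp add: lambda_system_def)
qed

definition repr :: "'x measure" where
  "repr = measure_of UNIV (sets borel) outer"

lemma sets_repr [measurable_cong]: "sets repr = sets borel"
  using sets.sigma_sets_eq[of "borel :: 'x measure"] by (simp add: repr_def)

lemma space_repr [simp]: "space repr = UNIV"
  by (simp add: repr_def)

text \<open>The Caratheodory-measurable sets form a \<sigma>-algebra containing the open sets, hence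
  all Borel sets, and \<open>outer\<close> is a measure on them.\<close>

lemma emeasure_repr:
  assumes "A \<in> sets borel"
  shows "emeasure repr A = outer A"
proof -
  have "measure_space UNIV (lambda_system UNIV (Pow UNIV) outer) outer"
    by (rule sigma_algebra.caratheodory_lemma[OF sigma_algebra_Pow outer_measure_space_outer])
  moreover have "sets borel \<subseteq> lambda_system UNIV (Pow UNIV) outer"
    unfolding sets_borel
    by (rule sigma_algebra.sigma_sets_subset)
      (use calculation open_in_lambda_system in \<open>auto simp: measure_space_def\<close>)
  ultimately have "measure_space UNIV (sets borel) outer"
    using measure_down[OF _ sets.sigma_algebra_axioms[of "borel :: 'x measure"]] by simp
  then show ?thesis
    using emeasure_measure_of_sigma[of UNIV "sets borel" outer A] assms
    by (simp add: measure_space_def repr_def)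
qed

lemma prob_space_repr: "prob_space repr"
  by (rule prob_spaceI) (simp add: emeasure_repr outer_open content_UNIV)

section \<open>Integration against the representing measure\<close>

text \<open>Layer-cake argument: \<open>n * u\<close> is cut into \<open>n\<close> slices of height
  at most 1, and slice \<open>k\<close> is below the open set \<open>P k\<close> on which
  \<open>n * u\<close> exceeds \<open>k\<close>. Hence \<open>n * \<Lambda> u\<close> is at most the
  integral of the number of sets \<open>P k\<close> containing the point, and this number is at most
  \<open>n * u + 1\<close>. Dividing by \<open>n\<close> leaves an error
  \<open>1 / n\<close>.\<close>

lemma le_integral_repr:
  assumes u: "continuous_on UNIV u" "\<And>x. 0 \<le> u x" "\<And>x. u x \<le> 1"
  shows "\<Lambda> u \<le> (LINT x|repr. u x)"
proof -
  interpret R: prob_space repr by (rule prob_space_repr)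
  have [measurable]: "u \<in> borel_measurable borel"
    using u(1) by (rule borel_measurable_continuous_onI)
  have int: "integrable repr u"
    by (rule R.integrable_const_bound[of _ 1]) (use u in auto)
  have key: "\<Lambda> u \<le> (LINT x|repr. u x) + 1 / real n" if n: "0 < n" for n :: nat
  proof -
    define w where "w k x = min 1 (max 0 (real n * u x - real k))" for k :: nat and x
    have cw: "continuous_on UNIV (w k)" for k
      unfolding w_def by (intro continuous_intros u)
    \<comment> \<open>The first \<open>N\<close> slices add up to \<open>n * u\<close> cut off at
      height \<open>N\<close>; for \<open>N = n\<close> the bound \<open>u x \<le> 1\<close> removes
      the cutoff.\<close>
    have sw: "(\<Sum>k<N. w k x) = min (real N) (real n * u x)" for x N
    proof (induction N)
      case 0
      then show ?case using u(2)[of x] by simp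
    next
      case (Suc N)
      then show ?case by (auto simp: w_def min_def max_def)
    qed
    define P where "P k = {x. real k < real n * u x}" for k :: nat
    have P: "open (P k)" for k
      unfolding P_def by (intro open_Collect_less continuous_intros u)
    then have Pm: "P k \<in> sets repr" for k
      by (simp add: sets_repr)
    have "\<Lambda> (w k) \<le> measure repr (P k)" for k
    proof -
      have "w k \<in> below (P k)"
        using cw by (auto simp: below_def P_def w_def)
      then have "ennreal (\<Lambda> (w k)) \<le> emeasure repr (P k)"
        using P[of k] by (simp add: emeasure_repr outer_open content_upper)
      then show ?thesis
        by (simp add: R.emeasure_eq_measure)
    qed
    then have "(\<Sum>k<n. \<Lambda> (w k)) \<le> (\<Sum>k<n. measure repr (P k))"
      by (rule sum_mono)
    also have "\<dots> = (LINT x|repr. (\<Sum>k<n. indicator (P k) x))"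
      using Pm by (subst Bochner_Integration.integral_sum) (auto simp: less_top[symmetric])
    also have "\<dots> \<le> (LINT x|repr. real n * u x + 1)"
    proof (rule integral_mono)
      show "integrable repr (\<lambda>x. \<Sum>k<n. indicator (P k) x :: real)"
        using Pm by (intro Bochner_Integration.integrable_sum) (auto simp: less_top[symmetric])
      show "integrable repr (\<lambda>x. real n * u x + 1)"
        using int by simp
      fix x
      \<comment> \<open>The cap \<open>real N\<close> carries the induction: set number
        \<open>N\<close> is counted only if \<open>N < n * u x\<close>, and then
        \<open>N + 1\<close> is below both terms of the new minimum.\<close>
      have "(\<Sum>k<N. indicator (P k) x) \<le> max 0 (min (real N) (real n * u x + 1))" for N
      proof (induction N)
        case (Suc N)
        then show ?case by (auto simp: P_def indicator_def min_def max_def split: if_splits)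
      qed simp
      then show "(\<Sum>k<n. indicator (P k) x) \<le> real n * u x + 1"
        using u(2)[of x] mult_nonneg_nonneg[of "real n" "u x"]
        by (smt (verit) min.cobounded2 of_nat_0_le_iff)
    qed
    also have "\<dots> = real n * (LINT x|repr. u x) + 1"
      using int R.prob_space by simp
    finally have "(\<Sum>k<n. \<Lambda> (w k)) \<le> real n * (LINT x|repr. u x) + 1" .
    moreover have "(\<Sum>k<n. \<Lambda> (w k)) = real n * \<Lambda> u"
    proof -
      have "min (real n) (real n * u x) = real n * u x" for x
        using u(3)[of x] n by (simp add: min_absorb2)
      then show ?thesis
        using sum[of "{..<n}" w] cw scale[OF u(1), of "real n"] by (simp add: sw)
    qed
    ultimately have "real n * \<Lambda> u \<le> real n * ((LINT x|repr. u x) + 1 / real n)"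
      using n by (simp add: algebra_simps)
    then show ?thesis
      using n by (simp add: mult_le_cancel_left)
  qed
  show ?thesis
  proof (rule field_le_epsilon)
    fix e :: real assume "0 < e"
    then obtain n where "inverse (real (Suc n)) < e"
      using reals_Archimedean by blast
    then show "\<Lambda> u \<le> (LINT x|repr. u x) + e"
      using key[of "Suc n"] by (simp add: inverse_eq_divide)
  qed
qed

text \<open>The one-sided bound is applied to \<open>p 1\<close> and \<open>p (-1)\<close>, the
  affine images of \<open>u\<close> and \<open>-u\<close> with values in [0, 1]. Both sides are
  normalised, so the constant 1/2 cancels.\<close>

theorem integral_repr:
  assumes u: "continuous_on UNIV u"
  shows "(LINT x|repr. u x) = \<Lambda> u"
proof -
  interpret R: prob_space repr by (rule prob_space_repr)
  have "compact (range u)"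
    using compact_continuous_image[OF u compact_space] .
  then obtain b where b: "\<And>x. \<bar>u x\<bar> \<le> b"
    using compact_imp_bounded bounded_real by (metis rangeI)
  \<comment> \<open>Adding 1 keeps \<open>B\<close> positive even for \<open>u = 0\<close>, so
    dividing by \<open>2 * B\<close> is safe.\<close>
  define B where "B = b + 1"
  have B: "0 < B" "\<bar>u x\<bar> \<le> B" for x
    using b[of x] by (auto simp: B_def)
  have [measurable]: "u \<in> borel_measurable borel"
    using u by (rule borel_measurable_continuous_onI)
  have int: "integrable repr u"
    by (rule R.integrable_const_bound[of _ B]) (use B in auto)
  define p where "p s x = (s * u x + B) / (2 * B)" for s x
  have p_eq: "p s = (\<lambda>x. (s / (2 * B)) * u x + 1 / 2)" for s
    using B by (auto simp: p_def field_simps fun_eq_iff)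
  have "s * \<Lambda> u \<le> s * (LINT x|repr. u x)" if s: "s = 1 \<or> s = -1" for s
  proof -
    have "\<Lambda> (p s) \<le> (LINT x|repr. p s x)"
    proof (rule le_integral_repr)
      show "continuous_on UNIV (p s)"
        unfolding p_eq by (intro continuous_intros u)
      show "0 \<le> p s x" "p s x \<le> 1" for x
        using B(1) B(2)[of x] s by (auto simp: p_def field_simps)
    qed
    moreover have "\<Lambda> (p s) = (s / (2 * B)) * \<Lambda> u + 1 / 2"
      unfolding p_eq using add[OF continuous_on_mult_left[OF u, of "s / (2 * B)"] continuous_on_const[of _ "1 / 2"]]
        scale[OF u, of "s / (2 * B)"] const[of "1 / 2"] by simp
    moreover have "(LINT x|repr. p s x) = (s / (2 * B)) * (LINT x|repr. u x) + 1 / 2"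
      unfolding p_eq using int R.prob_space by (subst Bochner_Integration.integral_add) auto
    ultimately have "(s / (2 * B)) * \<Lambda> u \<le> (s / (2 * B)) * (LINT x|repr. u x)"
      by simp
    then show ?thesis
      using B(1) by (simp add: divide_le_cancel)
  qed
  from this[of 1] this[of "-1"] show ?thesis
    by simp
qed

end

section \<open>Continuous functions and finite Borel measures\<close>

lemma compact_UNIV_bounded:
  fixes u :: "'x::topological_space \<Rightarrow> 'b::real_normed_vector"
  assumes "compact (UNIV :: 'x set)" "continuous_on UNIV u"
  obtains B where "0 < B" "\<And>x. norm (u x) \<le> B"
proof -
  have "bounded (range u)"
    using compact_continuous_image[OF assms(2,1)] by (rule compact_imp_bounded)
  then obtain B where "0 < B" "\<forall>y\<in>range u. norm y \<le> B"
    by (auto simp: bounded_pos)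
  then show ?thesis
    by (intro that[of B]) auto
qed

lemma integrable_continuous_compact_UNIV:
  fixes u :: "'x::topological_space \<Rightarrow> 'b::{banach, second_countable_topology}"
  assumes "compact (UNIV :: 'x set)" "finite_measure \<nu>" "sets \<nu> = sets borel" "continuous_on UNIV u"
  shows "integrable \<nu> u"
proof -
  obtain B where B: "\<And>x. norm (u x) \<le> B"
    using compact_UNIV_bounded[OF assms(1,4)] by blast
  have "u \<in> borel_measurable \<nu>"
    using borel_measurable_continuous_onI[OF assms(4)]
    by (simp add: measurable_cong_sets[OF assms(3) refl])
  then show ?thesis
    using B by (intro finite_measure.integrable_const_bound[OF assms(2), of _ B]) auto
qed

text \<open>Open sets form an intersection-stable generator, and by dominated convergence the
  measure of an open set is a limit of integrals of continuous functions.\<close>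

lemma measure_eqI_continuous:
  fixes \<mu> \<nu> :: "'x::topological_space measure"
  assumes X: "compact (UNIV :: 'x set)" "metrizable_space (euclidean :: 'x topology)"
    and \<mu>: "prob_space \<mu>" "sets \<mu> = sets borel"
    and \<nu>: "prob_space \<nu>" "sets \<nu> = sets borel"
    and eq: "\<And>u. continuous_on UNIV u \<Longrightarrow> (LINT x|\<mu>. u x) = (LINT x|\<nu>. u x :: real)"
  shows "\<mu> = \<nu>"
proof (rule measure_eqI_generator_eq[of "{U. open U}" UNIV _ _ "\<lambda>_. UNIV"])
  interpret M: prob_space \<mu> by fact
  interpret N: prob_space \<nu> by fact
  show "Int_stable {U :: 'x set. open U}"
    by (auto simp: Int_stable_def)
  show "sets \<mu> = sigma_sets UNIV {U. open U}" "sets \<nu> = sigma_sets UNIV {U. open U}"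
    using \<mu>(2) \<nu>(2) by (simp_all add: sets_borel)
  show "emeasure \<mu> UNIV \<noteq> \<infinity>"
    by simp
  fix U :: "'x set" assume "U \<in> {U. open U}"
  then have "open U" by simp
  obtain \<phi> :: "nat \<Rightarrow> 'x \<Rightarrow> real"
    where \<phi>: "\<And>n. continuous_on UNIV (\<phi> n)" "\<And>n x. 0 \<le> \<phi> n x" "\<And>n x. \<phi> n x \<le> 1"
      "\<And>x. (\<lambda>n. \<phi> n x) \<longlonglongrightarrow> indicator U x"
    using open_approx_continuous[OF X(2) \<open>open U\<close>] by metis
  have lim: "(\<lambda>n. LINT x|\<kappa>. \<phi> n x) \<longlonglongrightarrow> measure \<kappa> U" if \<kappa>: "prob_space \<kappa>" "sets \<kappa> = sets borel" for \<kappa>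
  proof -
    interpret K: prob_space \<kappa> by fact
    have U: "U \<in> sets \<kappa>"
      using \<open>open U\<close> \<kappa>(2) by simp
    have "(\<lambda>n. LINT x|\<kappa>. \<phi> n x) \<longlonglongrightarrow> (LINT x|\<kappa>. indicator U x)"
    proof (rule integral_dominated_convergence[where w="\<lambda>_. 1"])
      show "\<phi> n \<in> borel_measurable \<kappa>" for n
        using borel_measurable_continuous_onI[OF \<phi>(1)]
        by (simp add: measurable_cong_sets[OF \<kappa>(2) refl])
    qed (use U \<phi> in auto)
    then show ?thesis
      using U by (simp add: sets.sets_into_space Int_absorb1)
  qed
  have "measure \<mu> U = measure \<nu> U"
    using lim[OF \<mu>] lim[OF \<nu>] by (simp add: eq[OF \<phi>(1)] LIMSEQ_unique)
  then show "emeasure \<mu> U = emeasure \<nu> U"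
    by (simp add: M.emeasure_eq_measure N.emeasure_eq_measure)
qed auto

section \<open>Means over sets of positive measure\<close>

text \<open>A constant is its own mean, so the upper and lower bounds on means below become bounds
  on the integral of \<open>h - c\<close> over \<open>C\<close>.\<close>

lemma mean_on_minus_const:
  fixes \<mu> :: "'x::topological_space measure"
  assumes X: "compact (UNIV :: 'x set)"
    and \<mu>: "prob_space \<mu>" "sets \<mu> = sets borel"
    and C: "C \<in> sets borel" "0 < measure \<mu> C"
    and h: "continuous_on UNIV h"
  shows "mean_on \<mu> C h - c = (LINT x:C|\<mu>. h x - c) /\<^sub>R measure \<mu> C"
    and "set_integrable \<mu> C (\<lambda>x. h x - c)"
proof -
  interpret prob_space \<mu> by fact
  have C': "C \<in> sets \<mu>"
    using C \<mu> by simp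
  have int: "set_integrable \<mu> C k" if "continuous_on UNIV k" for k :: "'x \<Rightarrow> complex"
    unfolding set_integrable_def
    by (rule integrable_mult_indicator[OF C'])
      (rule integrable_continuous_compact_UNIV[OF X finite_measure_axioms \<mu>(2) that])
  have "(LINT x:C|\<mu>. h x - c) = (LINT x:C|\<mu>. h x) - measure \<mu> C *\<^sub>R c"
    using int[OF h] int[OF continuous_on_const] set_integral_const[OF C', of c] by simp
  then show "mean_on \<mu> C h - c = (LINT x:C|\<mu>. h x - c) /\<^sub>R measure \<mu> C"
    using C(2) by (simp add: mean_on_def scaleR_diff_right)
  show "set_integrable \<mu> C (\<lambda>x. h x - c)"
    by (intro int continuous_intros h)
qed

lemma mean_on_dist_le:
  fixes \<mu> :: "'x::topological_space measure"
  assumes X: "compact (UNIV :: 'x set)"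
    and \<mu>: "prob_space \<mu>" "sets \<mu> = sets borel"
    and C: "C \<in> sets borel" "0 < measure \<mu> C"
    and h: "continuous_on UNIV h" "\<And>x. norm (h x - c) \<le> e"
  shows "norm (mean_on \<mu> C h - c) \<le> e"
proof -
  note * = mean_on_minus_const[OF X \<mu> C h(1), of c]
  interpret prob_space \<mu> by fact
  have C': "C \<in> sets \<mu>"
    using C \<mu> by simp
  have "norm (LINT x:C|\<mu>. h x - c) \<le> (LINT x|\<mu>. norm (indicator C x *\<^sub>R (h x - c)))"
    unfolding set_lebesgue_integral_def by (rule integral_norm_bound)
  also have "\<dots> \<le> (LINT x|\<mu>. indicator C x * e)"
  proof (rule integral_mono)
    show "integrable \<mu> (\<lambda>x. norm (indicator C x *\<^sub>R (h x - c)))"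
      using *(2) unfolding set_integrable_def by (rule integrable_norm)
    show "integrable \<mu> (\<lambda>x. indicator C x * e)"
      using C' by (intro integrable_mult_left) (simp add: less_top[symmetric])
  qed (simp add: indicator_def h(2))
  also have "\<dots> = e * measure \<mu> C"
    using C' by (simp add: sets.sets_into_space Int_absorb1)
  finally show ?thesis
    using C(2) by (simp add: *(1) divide_inverse[symmetric] field_simps)
qed

lemma Re_mean_on_ge:
  fixes \<mu> :: "'x::topological_space measure"
  assumes X: "compact (UNIV :: 'x set)"
    and \<mu>: "prob_space \<mu>" "sets \<mu> = sets borel"
    and C: "C \<in> sets borel" "0 < measure \<mu> C"
    and h: "continuous_on UNIV h" "\<And>x. x \<in> C \<Longrightarrow> c \<le> Re (h x)"
  shows "c \<le> Re (mean_on \<mu> C h)"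
proof -
  note * = mean_on_minus_const[OF X \<mu> C h(1), of "of_real c"]
  have "Re (LINT x:C|\<mu>. h x - of_real c) = (LINT x|\<mu>. Re (indicator C x *\<^sub>R (h x - of_real c)))"
    using *(2) unfolding set_lebesgue_integral_def set_integrable_def by (rule integral_Re[symmetric])
  also have "0 \<le> \<dots>"
    by (intro Bochner_Integration.integral_nonneg) (auto simp: indicator_def h(2))
  finally have "0 \<le> Re (mean_on \<mu> C h - of_real c)"
    unfolding *(1) using C(2) by simp
  then show ?thesis
    by simp
qed

section \<open>Averages over compact sets\<close>

text \<open>Real counterpart of \<open>Avg\<close>. Complex functions are split into real and
  imaginary parts, so that order and positivity become available.\<close>

definition real_avg ::
  "'g measure \<Rightarrow> ('g \<Rightarrow> 'x \<Rightarrow> 'x) \<Rightarrow> 'g set \<Rightarrow> ('x \<Rightarrow> real) \<Rightarrow> 'x \<Rightarrow> real" where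
  "real_avg m T K u x = (LINT g:K|m. u (T g x)) / measure m K"

locale compact_action =
  fixes m :: "'g::{topological_group_add, t2_space} measure"
    and T :: "'g \<Rightarrow> 'x::topological_space \<Rightarrow> 'x"
  assumes haar: "bi_invariant_haar_measure m"
    and action: "continuous_action T"
    and compact_X: "compact (UNIV :: 'x set)"
    and metrizable_X: "metrizable_space (euclidean :: 'x topology)"
begin

lemma sets_m [measurable_cong]: "sets m = sets borel"
  and finite_compact: "compact K \<Longrightarrow> emeasure m K < \<infinity>"
  and translate_m: "distr m borel ((+) g) = m"
  using haar
  by (auto simp: bi_invariant_haar_measure_def left_haar_measure_def radon_measure_def)

lemma compact_sets: "compact K \<Longrightarrow> K \<in> sets m"
  by (simp add: sets_m compact_imp_closed)

lemma T_add: "T (g + h) x = T g (T h x)"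
  using action by (simp add: continuous_action_def)

lemma continuous_orbit:
  assumes "continuous_on UNIV u"
  shows "continuous_on UNIV (\<lambda>p. u (T (fst p) (snd p)))" "continuous_on UNIV (\<lambda>g. u (T g x))"
    "continuous_on UNIV (\<lambda>x. u (T g x))"
proof -
  show *: "continuous_on UNIV (\<lambda>p. u (T (fst p) (snd p)))"
    using action by (intro continuous_on_compose2[OF assms])
      (auto simp: continuous_action_def case_prod_unfold)
  show "continuous_on UNIV (\<lambda>g. u (T g x))"
    using continuous_on_compose2[OF *, of UNIV "\<lambda>g. (g, x)"] by (simp add: continuous_intros)
  show "continuous_on UNIV (\<lambda>x. u (T g x))"
    using continuous_on_compose2[OF *, of UNIV "\<lambda>x. (g, x)"] by (simp add: continuous_intros)
qed

lemma set_integrable_orbit: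
  fixes u :: "'x \<Rightarrow> 'b::{banach, second_countable_topology}"
  assumes K: "K \<in> sets m" "emeasure m K < \<infinity>" and u: "continuous_on UNIV u"
  shows "set_integrable m K (\<lambda>g. u (T g x))"
proof -
  obtain B where B: "\<And>x. norm (u x) \<le> B"
    using compact_UNIV_bounded[OF compact_X u] by blast
  show ?thesis
    unfolding set_integrable_def
  proof (rule integrableI_bounded_set_indicator[OF K(1) _ K(2)])
    show "(\<lambda>g. u (T g x)) \<in> borel_measurable m"
      using borel_measurable_continuous_onI[OF continuous_orbit(2)[OF u]]
      by (simp add: measurable_cong_sets[OF sets_m refl])
  qed (use B in auto)
qed

lemma Avg_eq:
  assumes K: "compact K" and f: "continuous_on UNIV f"
  shows "Avg m T K f x = Complex (real_avg m T K (\<lambda>x. Re (f x)) x) (real_avg m T K (\<lambda>x. Im (f x)) x)"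
proof -
  have int: "integrable m (\<lambda>g. indicator K g *\<^sub>R f (T g x))"
    using set_integrable_orbit[OF compact_sets[OF K] finite_compact[OF K] f]
    by (simp add: set_integrable_def)
  show ?thesis
    using integral_Re[OF int] integral_Im[OF int]
    by (simp add: complex_eq_iff Avg_def real_avg_def set_lebesgue_integral_def divide_inverse mult.commute)
qed

text \<open>The uniform approximation by finite averages replaces Fubini's theorem: when \<open>'g\<close> is not second
  countable, continuity of \<open>(g, x) \<mapsto> u (T g x)\<close> does not directly give measurability for the product
  \<open>\<sigma>\<close>-algebra.\<close>

lemma real_avg_approx:
  assumes K: "compact K" "0 < measure m K" and u: "continuous_on UNIV u" and e: "0 < e"
  obtains n :: nat and w :: "nat \<Rightarrow> real" and h :: "nat \<Rightarrow> 'g"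
  where "(\<Sum>j<n. w j) = 1" "\<And>x. \<bar>real_avg m T K u x - (\<Sum>j<n. w j * u (T (h j) x))\<bar> \<le> e"
proof -
  \<comment> \<open>Tube lemma: compactness of the space gives a neighbourhood of \<open>h\<close>
    that works for all \<open>x\<close> at once.\<close>
  have "\<exists>V. h \<in> V \<and> open V \<and> (\<forall>g\<in>V. \<forall>x. \<bar>u (T g x) - u (T h x)\<bar> < e)" for h
  proof -
    define W where "W = {p. \<bar>u (T (fst p) (snd p)) - u (T h (snd p))\<bar> < e}"
    have "continuous_on UNIV (\<lambda>p :: 'g \<times> 'x. u (T h (snd p)))"
      by (rule continuous_on_compose2[OF continuous_orbit(3)[OF u]]) (auto intro!: continuous_intros)
    then have "open W"
      unfolding W_def by (intro open_Collect_less continuous_intros continuous_orbit(1)[OF u])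
    moreover have "{h} \<times> UNIV \<subseteq> W"
      using e by (auto simp: W_def)
    ultimately have "\<exists>V. h \<in> V \<and> open V \<and> V \<times> UNIV \<subseteq> W"
      by (rule Elementary_Topology.tube_lemma[OF compact_X])
    then obtain V where V: "h \<in> V" "open V" "V \<times> UNIV \<subseteq> W"
      by blast
    have "\<bar>u (T g x) - u (T h x)\<bar> < e" if "g \<in> V" for g x
      using subsetD[OF V(3), of "(g, x)"] that by (simp add: W_def)
    with V show ?thesis
      by blast
  qed
  then obtain V where V: "\<And>h. h \<in> V h" "\<And>h. open (V h)"
      "\<And>h g x. g \<in> V h \<Longrightarrow> \<bar>u (T g x) - u (T h x)\<bar> < e"
    by metis
  have "K \<subseteq> (\<Union>h\<in>UNIV. V h)"
    using V(1) by blast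
  then obtain I where I: "finite I" "K \<subseteq> (\<Union>h\<in>I. V h)"
    using compactE_image[OF K(1), of UNIV V] V(2) by metis
  obtain xs where xs: "set xs = I"
    using finite_list[OF I(1)] by blast
  define n where "n = length xs"
  define h where "h j = xs ! j" for j
  have Kh: "K \<subseteq> (\<Union>j<n. V (h j))"
    using I(2) unfolding xs[symmetric] n_def h_def by (fastforce simp: in_set_conv_nth)
  \<comment> \<open>The finite cover is cut into disjoint pieces; the weight of \<open>h j\<close>
    will be the share of \<open>K\<close> occupied by piece \<open>j\<close>.\<close>
  define A where "A = disjointed (\<lambda>j. K \<inter> V (h j))"
  have A_sub: "A j \<subseteq> K \<inter> V (h j)" for j
    unfolding A_def by (rule disjointed_subset)
  have A_sets: "A j \<in> sets m" for j
    unfolding A_def disjointed_def using compact_sets[OF K(1)] V(2)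
    by (intro sets.Diff sets.finite_UN sets.Int) (auto simp: sets_m)
  have K_UN: "K = (\<Union>j<n. A j)"
  proof -
    have "(\<Union>j<n. A j) = (\<Union>j<n. K \<inter> V (h j))"
      unfolding A_def using finite_UN_disjointed_eq[of "\<lambda>j. K \<inter> V (h j)" n]
      by (simp add: atLeast0LessThan)
    then show ?thesis
      using Kh by auto
  qed
  have A_disj: "disjoint_family A"
    unfolding A_def by (rule disjoint_family_disjointed)
  have A_fin: "emeasure m (A j) < \<infinity>" for j
    using emeasure_mono[OF _ compact_sets[OF K(1)], of "A j"] A_sub[of j] finite_compact[OF K(1)]
    by (auto intro: le_less_trans)
  \<comment> \<open>For \<open>g\<close> in \<open>K\<close> only the piece \<open>j0\<close>
    containing \<open>g\<close> contributes. Off \<open>K\<close> all terms vanish and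
    \<open>j0\<close> is arbitrary.\<close>
  have ind: "(\<Sum>j<n. indicator (A j) g * c j) = (if g \<in> K then c j0 else 0 :: real)"
    if "g \<in> K \<Longrightarrow> j0 < n \<and> g \<in> A j0" for g j0 c
  proof (cases "g \<in> K")
    case True
    then have j0: "j0 < n" "g \<in> A j0"
      using that by auto
    have "(\<Sum>j<n. indicator (A j) g * c j) = (\<Sum>j<n. if j = j0 then c j else 0)"
      using A_disj j0 by (intro sum.cong) (auto simp: disjoint_family_on_def indicator_def)
    then show ?thesis
      using True j0 by simp
  next
    case False
    then show ?thesis
      using K_UN by (auto intro!: sum.neutral simp: indicator_def)
  qed
  have ex: "\<exists>j0. g \<in> K \<longrightarrow> j0 < n \<and> g \<in> A j0" for g
    using K_UN by blast
  have int_A: "integrable m (\<lambda>g. indicator (A j) g * c :: real)" for j c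
    using A_sets A_fin by simp
  define w where "w j = measure m (A j) / measure m K" for j
  have "(\<Sum>j<n. w j) = 1"
  proof -
    have "measure m K = (\<Sum>j<n. measure m (A j))"
      unfolding K_UN using A_disj A_sets A_fin
      by (intro measure_finite_Union) (auto simp: disjoint_family_on_def less_top[symmetric])
    then show ?thesis
      using K(2) by (simp add: w_def sum_divide_distrib[symmetric])
  qed
  moreover have "\<bar>real_avg m T K u x - (\<Sum>j<n. w j * u (T (h j) x))\<bar> \<le> e" for x
  proof -
    let ?s = "\<lambda>g. \<Sum>j<n. indicator (A j) g * u (T (h j) x)"
    have int_u: "integrable m (\<lambda>g. indicator K g * u (T g x))"
      using set_integrable_orbit[OF compact_sets[OF K(1)] finite_compact[OF K(1)] u]
      by (simp add: set_integrable_def)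
    have int_s: "integrable m ?s"
      by (intro Bochner_Integration.integrable_sum int_A)
    have "(LINT g|m. ?s g) = (\<Sum>j<n. measure m (A j) * u (T (h j) x))"
      using int_A A_sets by (subst Bochner_Integration.integral_sum)
        (auto simp: sets.sets_into_space Int_absorb1)
    then have "(LINT g:K|m. u (T g x)) - (\<Sum>j<n. measure m (A j) * u (T (h j) x)) =
        (LINT g|m. indicator K g * u (T g x) - ?s g)"
      using int_u int_s by (simp add: set_lebesgue_integral_def)
    also have "\<bar>\<dots>\<bar> \<le> (LINT g|m. indicator K g * e)"
    proof -
      have "\<bar>LINT g|m. indicator K g * u (T g x) - ?s g\<bar> \<le>
          (LINT g|m. \<bar>indicator K g * u (T g x) - ?s g\<bar>)"
        by (rule integral_abs_bound)
      also have "\<dots> \<le> (LINT g|m. indicator K g * e)"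
      proof (rule integral_mono)
        show "integrable m (\<lambda>g. \<bar>indicator K g * u (T g x) - ?s g\<bar>)"
          using int_u int_s by (intro integrable_abs Bochner_Integration.integrable_diff)
        show "integrable m (\<lambda>g. indicator K g * e)"
          using compact_sets[OF K(1)] finite_compact[OF K(1)] by simp
        fix g
        obtain j0 where j0: "g \<in> K \<Longrightarrow> j0 < n \<and> g \<in> A j0"
          using ex by blast
        show "\<bar>indicator K g * u (T g x) - ?s g\<bar> \<le> indicator K g * e"
        proof -
          have "?s g = (if g \<in> K then u (T (h j0) x) else 0)"
            by (rule ind) (rule j0)
          then show ?thesis
            using j0 A_sub[of j0] V(3)[of g "h j0" x] by (cases "g \<in> K") auto
        qed
      qed
      finally show ?thesis .
    qed
    also have "\<dots> = e * measure m K"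
      using compact_sets[OF K(1)] by (simp add: sets.sets_into_space Int_absorb1)
    finally have "\<bar>(LINT g:K|m. u (T g x)) - (\<Sum>j<n. measure m (A j) * u (T (h j) x))\<bar>
        \<le> e * measure m K" .
    moreover have "real_avg m T K u x - (\<Sum>j<n. w j * u (T (h j) x)) =
        ((LINT g:K|m. u (T g x)) - (\<Sum>j<n. measure m (A j) * u (T (h j) x))) / measure m K"
      by (simp add: real_avg_def w_def diff_divide_distrib sum_divide_distrib)
    ultimately show ?thesis
      using K(2) by (simp add: abs_divide pos_divide_le_eq)
  qed
  ultimately show ?thesis
    by (rule that)
qed

text \<open>The finite averages of \<open>real_avg_approx\<close> are continuous and converge
  uniformly.\<close>

lemma continuous_real_avg:
  assumes K: "compact K" "0 < measure m K" and u: "continuous_on UNIV u"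
  shows "continuous_on UNIV (real_avg m T K u)"
proof -
  have "\<exists>v. continuous_on UNIV v \<and> (\<forall>x. \<bar>real_avg m T K u x - v x\<bar> \<le> inverse (real (Suc k)))" for k
  proof -
    obtain n :: nat and w :: "nat \<Rightarrow> real" and h :: "nat \<Rightarrow> 'g" where
      "\<And>x. \<bar>real_avg m T K u x - (\<Sum>j<n. w j * u (T (h j) x))\<bar> \<le> inverse (real (Suc k))"
      by (rule real_avg_approx[OF K u, of "inverse (real (Suc k))"]) auto
    then show ?thesis
      by (intro exI[of _ "\<lambda>x. \<Sum>j<n. w j * u (T (h j) x)"] conjI allI continuous_intros
          continuous_orbit(3)[OF u])
  qed
  then obtain v where v: "\<And>k. continuous_on UNIV (v k)"
      "\<And>k x. \<bar>real_avg m T K u x - v k x\<bar> \<le> inverse (real (Suc k))"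
    by metis
  have "uniform_limit UNIV v (real_avg m T K u) sequentially"
  proof (rule uniform_limitI)
    fix e :: real assume "0 < e"
    have "\<forall>\<^sub>F k in sequentially. inverse (real (Suc k)) < e"
      by (rule order_tendstoD(2)[OF LIMSEQ_inverse_real_of_nat \<open>0 < e\<close>])
    then show "\<forall>\<^sub>F k in sequentially. \<forall>x\<in>UNIV. dist (v k x) (real_avg m T K u x) < e"
      by eventually_elim (use v(2) in \<open>auto simp: dist_real_def abs_minus_commute intro: le_less_trans\<close>)
  qed
  then show ?thesis
    by (rule uniform_limit_theorem[rotated]) (auto simp: v(1))
qed

lemma continuous_Avg:
  assumes "compact K" "0 < measure m K" "continuous_on UNIV f"
  shows "continuous_on UNIV (Avg m T K f)"
proof -
  have "Avg m T K f = (\<lambda>x. Complex (real_avg m T K (\<lambda>x. Re (f x)) x) (real_avg m T K (\<lambda>x. Im (f x)) x))"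
    using Avg_eq[OF assms(1,3)] by auto
  then show ?thesis
    using assms by (auto simp: Complex_eq intro!: continuous_intros continuous_real_avg)
qed

lemma measurable_T: "T g \<in> measurable borel borel"
proof (rule borel_measurableI)
  fix S :: "'x set" assume "open S"
  have "continuous_on UNIV (T g)"
    using continuous_orbit(3)[of "\<lambda>x. x"] by (simp add: continuous_on_id)
  then have "open (T g -` S)"
    using \<open>open S\<close> by (simp add: continuous_on_open_vimage)
  then show "T g -` S \<inter> space borel \<in> sets borel"
    by simp
qed

lemma integral_distr_T:
  assumes "sets \<nu> = sets borel" "continuous_on UNIV u"
  shows "(LINT x|distr \<nu> borel (T g). u x) = (LINT x|\<nu>. u (T g x) :: real)"
  using borel_measurable_continuous_onI[OF assms(2)] measurable_T[of g]
  by (intro integral_distr) (simp_all add: measurable_cong_sets[OF assms(1) refl])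

text \<open>Otherwise an approximating finite average would be at most
  \<open>(LINT x|\<nu>. u x) - e / 2\<close> everywhere, whereas its \<nu>-integral is that of
  \<open>u\<close>, by invariance and because the weights sum to 1.\<close>

lemma ex_real_avg_gt:
  assumes K: "compact K" "0 < measure m K" and u: "continuous_on UNIV u"
    and \<nu>: "\<nu> \<in> invariant_prob_measures T" and e: "0 < e"
  shows "\<exists>x. (LINT x|\<nu>. u x) - e < real_avg m T K u x"
proof (rule ccontr)
  assume "\<not> ?thesis"
  then have le: "real_avg m T K u x \<le> (LINT x|\<nu>. u x) - e" for x
    by (simp add: not_less)
  have \<nu>': "prob_space \<nu>" "sets \<nu> = sets borel" "distr \<nu> borel (T g) = \<nu>" for g
    using \<nu> by (auto simp: invariant_prob_measures_def)
  interpret prob_space \<nu> by fact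
  obtain n :: nat and w :: "nat \<Rightarrow> real" and h :: "nat \<Rightarrow> 'g" where
    w: "(\<Sum>j<n. w j) = 1" and
    approx: "\<And>x. \<bar>real_avg m T K u x - (\<Sum>j<n. w j * u (T (h j) x))\<bar> \<le> e / 2"
    by (rule real_avg_approx[OF K u, of "e / 2"]) (use e in auto)
  have int: "integrable \<nu> (\<lambda>x. u (T g x))" for g
    by (rule integrable_continuous_compact_UNIV[OF compact_X finite_measure_axioms \<nu>'(2)
          continuous_orbit(3)[OF u]])
  have inv: "(LINT x|\<nu>. u (T g x)) = (LINT x|\<nu>. u x)" for g
    using integral_distr_T[OF \<nu>'(2) u, of g] \<nu>'(3) by simp
  have "(LINT x|\<nu>. u x) = (\<Sum>j<n. w j * (LINT x|\<nu>. u x))"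
    using w by (simp flip: sum_distrib_right)
  also have "\<dots> = (LINT x|\<nu>. (\<Sum>j<n. w j * u (T (h j) x)))"
    using int inv by (subst Bochner_Integration.integral_sum) auto
  also have "\<dots> \<le> (LINT x|\<nu>. (LINT x|\<nu>. u x) - e / 2)"
  proof (rule integral_mono)
    show "integrable \<nu> (\<lambda>x. \<Sum>j<n. w j * u (T (h j) x))"
      using int by (intro Bochner_Integration.integrable_sum) auto
    show "(\<Sum>j<n. w j * u (T (h j) x)) \<le> (LINT x|\<nu>. u x) - e / 2" for x
      using approx[of x] le[of x] by linarith
  qed simp
  also have "\<dots> = (LINT x|\<nu>. u x) - e / 2"
    using prob_space by simp
  finally show False
    using e by simp
qed

text \<open>Left invariance of \<open>m\<close> turns the integral of \<open>u\<close> composed with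
  \<open>T h\<close> over \<open>K\<close> into an integral of \<open>u\<close> over the left
  translate of \<open>K\<close>. The two domains differ by the symmetric difference, on which the
  integrand is bounded by \<open>B\<close>.\<close>

lemma real_avg_translate:
  assumes K: "compact K" "0 < measure m K" and u: "continuous_on UNIV u" "\<And>x. \<bar>u x\<bar> \<le> B"
  shows "\<bar>real_avg m T K (\<lambda>x. u (T h x)) x - real_avg m T K u x\<bar> \<le>
    B * (measure m (sym_diff ((\<lambda>g. h + g) ` K) K) / measure m K)"
proof -
  have add_cont: "continuous_on S (\<lambda>g. h + g)" for S :: "'g set"
    unfolding continuous_on_def by (intro ballI tendsto_add tendsto_const tendsto_ident_at)
  let ?K = "(\<lambda>g. h + g) ` K"
  have hK: "compact ?K"
    by (rule compact_continuous_image[OF add_cont K(1)])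
  have [measurable]: "(\<lambda>g. u (T g x)) \<in> borel_measurable borel" "(+) h \<in> borel_measurable borel"
    by (auto intro!: borel_measurable_continuous_onI continuous_orbit(2) u add_cont)
  have [measurable]: "?K \<in> sets borel" "K \<in> sets borel"
    using compact_sets[OF hK] compact_sets[OF K(1)] by (auto simp: sets_m)
  \<comment> \<open>Moving the indicator to the translate makes the integrand a function of
    \<open>h + g\<close>, so the shift can be absorbed into \<open>m\<close>.\<close>
  have "(LINT g:K|m. u (T h (T g x))) = (LINT g|m. indicator ?K (h + g) * u (T (h + g) x))"
    unfolding set_lebesgue_integral_def
    by (intro Bochner_Integration.integral_cong) (auto simp: T_add indicator_def)
  also have "\<dots> = (LINT g|distr m borel ((+) h). indicator ?K g * u (T g x))"
    by (subst integral_distr) auto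
  also have "\<dots> = (LINT g:?K|m. u (T g x))"
    by (simp add: translate_m set_lebesgue_integral_def)
  finally have eq: "(LINT g:K|m. u (T h (T g x))) = (LINT g:?K|m. u (T g x))" .
  have int: "integrable m (\<lambda>g. indicator L g * u (T g x))" if "compact L" for L
    using set_integrable_orbit[OF compact_sets[OF that] finite_compact[OF that] u(1)]
    by (simp add: set_integrable_def)
  have fin: "emeasure m (sym_diff ?K K) < \<infinity>"
    using emeasure_mono[of "sym_diff ?K K" "?K \<union> K" m] finite_compact[OF compact_Un[OF hK K(1)]]
    by (auto intro: le_less_trans simp: sets_m)
  have "\<bar>(LINT g:?K|m. u (T g x)) - (LINT g:K|m. u (T g x))\<bar> =
      \<bar>LINT g|m. indicator ?K g * u (T g x) - indicator K g * u (T g x)\<bar>"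
    using int[OF hK] int[OF K(1)] by (simp add: set_lebesgue_integral_def)
  also have "\<dots> \<le> (LINT g|m. \<bar>indicator ?K g * u (T g x) - indicator K g * u (T g x)\<bar>)"
    by (rule integral_abs_bound)
  also have "\<dots> \<le> (LINT g|m. indicator (sym_diff ?K K) g * B)"
  proof (rule integral_mono)
    show "integrable m (\<lambda>g. \<bar>indicator ?K g * u (T g x) - indicator K g * u (T g x)\<bar>)"
      by (intro integrable_abs Bochner_Integration.integrable_diff int hK K)
    show "integrable m (\<lambda>g. indicator (sym_diff ?K K) g * B)"
      using fin by (auto simp: sets_m)
    show "\<bar>indicator ?K g * u (T g x) - indicator K g * u (T g x)\<bar> \<le> indicator (sym_diff ?K K) g * B" for g
      using u(2)[of "T g x"] by (simp add: indicator_def)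
  qed
  also have "\<dots> = B * measure m (sym_diff ?K K)"
    by (simp add: sets.sets_into_space Int_absorb1 sets_m)
  finally have "\<bar>(LINT g:?K|m. u (T g x)) - (LINT g:K|m. u (T g x))\<bar> \<le> B * measure m (sym_diff ?K K)" .
  then show ?thesis
    using K(2) unfolding real_avg_def eq
    by (simp flip: diff_divide_distrib) (simp add: abs_divide divide_right_mono)
qed

end

section \<open>Limits along nets\<close>

lemma net_filter_neq_bot: "net_filter \<noteq> (bot :: 'i::directed_preorder filter)"
  unfolding trivial_limit_def eventually_net_filter by (auto intro: order_refl)

lemma tendsto_proj_nhds:
  fixes \<Lambda> :: "'a \<Rightarrow> 'b::topological_space"
  shows "((\<lambda>M. M v) \<longlongrightarrow> \<Lambda> v) (nhds \<Lambda>)"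
proof (rule topological_tendstoI)
  fix S :: "'b set" assume "open S" "\<Lambda> v \<in> S"
  moreover have "open ((\<lambda>M :: 'a \<Rightarrow> 'b. M v) -` S)"
    by (rule open_vimage[OF \<open>open S\<close> continuous_on_product_coordinates])
  ultimately show "\<forall>\<^sub>F M in nhds \<Lambda>. M v \<in> S"
    unfolding eventually_nhds by (intro exI[of _ "(\<lambda>M. M v) -` S"]) auto
qed

text \<open>Tychonoff: all \<open>L i\<close> lie in a product of compact intervals, so they have a
  cluster point in the product topology. The filter \<open>\<Psi>\<close> of its neighbourhoods, met
  with the image of \<open>\<Phi>\<close>, plays the role of a convergent subnet.\<close>

lemma bounded_functionals_cluster:
  fixes L :: "'i \<Rightarrow> 'a \<Rightarrow> real"
  assumes "\<Phi> \<noteq> bot" and "\<And>v. \<exists>b. \<forall>i. \<bar>L i v\<bar> \<le> b"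
  obtains \<Lambda> \<Psi> where "\<Psi> \<noteq> bot" "\<Psi> \<le> filtermap L \<Phi>" "\<And>v. ((\<lambda>M. M v) \<longlongrightarrow> \<Lambda> v) \<Psi>"
proof -
  obtain b where b: "\<And>i v. \<bar>L i v\<bar> \<le> b v"
    using assms(2) by metis
  define S where "S = (\<Pi>\<^sub>E v\<in>UNIV. {- b v..b v})"
  have "compactin (product_topology (\<lambda>_. euclidean) UNIV) S"
    unfolding S_def compactin_PiE by simp
  then have "compact S"
    by (simp add: euclidean_product_topology)
  moreover have "\<forall>\<^sub>F M in filtermap L \<Phi>. M \<in> S"
    using b by (auto simp: eventually_filtermap S_def PiE_UNIV_domain abs_le_iff minus_le_iff)
  ultimately obtain \<Lambda> where \<Lambda>: "inf (nhds \<Lambda>) (filtermap L \<Phi>) \<noteq> bot"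
    using assms(1) unfolding compact_filter by (metis filtermap_bot_iff)
  show ?thesis
  proof (rule that[of "inf (nhds \<Lambda>) (filtermap L \<Phi>)" \<Lambda>])
    show "((\<lambda>M. M v) \<longlongrightarrow> \<Lambda> v) (inf (nhds \<Lambda>) (filtermap L \<Phi>))" for v
      by (rule tendsto_mono[OF inf_le1 tendsto_proj_nhds])
  qed (use \<Lambda> in auto)
qed

lemma means_of_averages_converge_mono:
  fixes \<mu> :: "'a::topological_space measure" and F :: "'b::directed_preorder \<Rightarrow> 'g set"
  assumes "\<S> \<subseteq> \<S>'" and conv: "means_of_averages_converge \<S>' m T \<mu> F"
  shows "means_of_averages_converge \<S> m T \<mu> F"
  unfolding means_of_averages_converge_def
proof (intro allI impI)
  fix C :: "'b \<Rightarrow> 'a set" and f :: "'a \<Rightarrow> complex"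
  assume C: "\<forall>i. C i \<in> \<S> \<and> 0 < measure \<mu> (C i)" and f: "continuous_on UNIV f"
  have "C i \<in> \<S>' \<and> 0 < measure \<mu> (C i)" for i
    using C assms(1) by blast
  then show "((\<lambda>i. mean_on \<mu> (C i) (Avg m T (F i) f)) \<longlongrightarrow> (LINT x|\<mu>. f x)) net_filter"
    by (rule conv[unfolded means_of_averages_converge_def, rule_format, OF _ f])
qed

context compact_action
begin

section \<open>Averages at a point as positive normalised functionals\<close>

lemma real_avg_linear:
  assumes K: "compact K" and u: "continuous_on UNIV u" and v: "continuous_on UNIV v"
  shows "real_avg m T K (\<lambda>x. u x + v x) x = real_avg m T K u x + real_avg m T K v x"
    and "real_avg m T K (\<lambda>x. c * u x) x = c * real_avg m T K u x"
  using set_integrable_orbit[OF compact_sets[OF K] finite_compact[OF K] u]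
    set_integrable_orbit[OF compact_sets[OF K] finite_compact[OF K] v]
  by (simp_all add: real_avg_def add_divide_distrib)

lemma real_avg_nonneg:
  assumes "\<And>x. 0 \<le> u x"
  shows "0 \<le> real_avg m T K u x"
  unfolding real_avg_def set_lebesgue_integral_def
  by (intro divide_nonneg_nonneg Bochner_Integration.integral_nonneg) (auto simp: assms)

lemma real_avg_one:
  assumes "compact K" "0 < measure m K"
  shows "real_avg m T K (\<lambda>_. 1) x = 1"
  using set_integral_const[OF compact_sets[OF assms(1)], of "1 :: real"] finite_compact[OF assms(1)] assms(2)
  by (simp add: real_avg_def)

text \<open>Positivity is applied to \<open>B + u\<close> and \<open>B - u\<close>; linearity and
  normalisation evaluate both averages.\<close>

lemma abs_real_avg_le:
  assumes K: "compact K" "0 < measure m K" and u: "continuous_on UNIV u" "\<And>x. \<bar>u x\<bar> \<le> B"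
  shows "\<bar>real_avg m T K u x\<bar> \<le> B"
proof -
  have nonneg: "0 \<le> real_avg m T K (\<lambda>x. B * 1 + s * u x) x" if "s = 1 \<or> s = -1" for s
  proof (rule real_avg_nonneg)
    show "0 \<le> B * 1 + s * u y" for y
      using that u(2)[of y] by auto
  qed
  have affine: "real_avg m T K (\<lambda>x. B * 1 + s * u x) x = B + s * real_avg m T K u x" for s
    using real_avg_linear(1)[OF K(1), of "\<lambda>_. B * 1" "\<lambda>x. s * u x"]
      real_avg_linear(2)[OF K(1), of "\<lambda>_. 1" "\<lambda>_. 1" B] real_avg_linear(2)[OF K(1) u(1) u(1), of s]
      real_avg_one[OF K] u(1) by (simp add: continuous_on_mult_left)
  have "0 \<le> B + s * real_avg m T K u x" if "s = 1 \<or> s = -1" for s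
    using nonneg[OF that] unfolding affine .
  from this[of 1] this[of "-1"] show ?thesis
    by simp
qed

section \<open>From unique ergodicity to uniform convergence of the averages\<close>

text \<open>Linearity, positivity, normalisation and the distance bound are closed conditions, so a
  cluster point of the evaluations at \<open>x i\<close> inherits them; invariance holds in the
  limit by the Folner condition. \<open>\<Phi>\<close> stands for a subnet of the index set.\<close>

lemma ergodic_limit_measure:
  assumes F: "folner_net m (F :: 'i::directed_preorder \<Rightarrow> 'g set)"
    and \<Phi>: "\<Phi> \<noteq> bot" "\<Phi> \<le> net_filter"
    and u: "continuous_on UNIV u" and far: "\<forall>\<^sub>F i in \<Phi>. e \<le> \<bar>real_avg m T (F i) u (x i) - c\<bar>"
  shows "\<exists>\<nu>\<in>invariant_prob_measures T. e \<le> \<bar>(LINT x|\<nu>. u x) - c\<bar>"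
proof -
  have K: "compact (F i)" "0 < measure m (F i)" for i
    using F by (auto simp: folner_net_def)
  have folner: "((\<lambda>i. measure m (sym_diff ((\<lambda>x. h + x) ` F i) (F i)) / measure m (F i)) \<longlongrightarrow> 0) \<Phi>" for h
    using F \<Phi>(2) by (auto simp: folner_net_def intro: tendsto_mono)
  \<comment> \<open>The value 0 at discontinuous functions makes the family bounded at every
    argument, as \<open>bounded_functionals_cluster\<close> demands.\<close>
  define L where "L i v = (if continuous_on UNIV v then real_avg m T (F i) v (x i) else 0)" for i v
  have L: "L i v = real_avg m T (F i) v (x i)" if "continuous_on UNIV v" for i v
    using that by (simp add: L_def)
  have bdd: "\<exists>b. \<forall>i. \<bar>L i v\<bar> \<le> b" for v
  proof (cases "continuous_on UNIV v")
    case True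
    then obtain B where "\<And>x. norm (v x) \<le> B"
      using compact_UNIV_bounded[OF compact_X] by blast
    then show ?thesis
      using abs_real_avg_le[OF K True, of B] by (intro exI[of _ B]) (auto simp: L[OF True])
  qed (auto simp: L_def)
  obtain \<Lambda> \<Psi> where \<Psi>: "\<Psi> \<noteq> bot" "\<Psi> \<le> filtermap L \<Phi>" and lim: "\<And>v. ((\<lambda>M. M v) \<longlongrightarrow> \<Lambda> v) \<Psi>"
    by (rule bounded_functionals_cluster[where L=L, OF \<Phi>(1) bdd]) blast
  \<comment> \<open>Whatever holds for \<open>L i\<close> eventually along \<open>\<Phi>\<close>
    holds eventually along \<open>\<Psi>\<close>; each axiom of the functional is transferred this
    way.\<close>
  have ev: "\<forall>\<^sub>F M in \<Psi>. P M" if "\<forall>\<^sub>F i in \<Phi>. P (L i)" for P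
    using \<Psi>(2) that by (simp add: le_filter_def eventually_filtermap)
  interpret probability_functional \<Lambda>
  proof
    show "compact (UNIV :: 'x set)" "metrizable_space (euclidean :: 'x topology)"
      by (rule compact_X metrizable_X)+
    fix v w :: "'x \<Rightarrow> real" and c :: real
    assume v: "continuous_on UNIV v"
    show "\<Lambda> (\<lambda>x. c * v x) = c * \<Lambda> v"
    proof (rule tendsto_unique[OF \<Psi>(1) lim])
      have "\<forall>\<^sub>F M in \<Psi>. c * M v = M (\<lambda>x. c * v x)"
        by (intro ev always_eventually allI)
          (simp add: L v continuous_on_mult_left real_avg_linear(2)[OF K(1) v v])
      then show "((\<lambda>M. M (\<lambda>x. c * v x)) \<longlongrightarrow> c * \<Lambda> v) \<Psi>"
        by (rule Lim_transform_eventually[rotated]) (intro tendsto_intros lim)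
    qed
    show "0 \<le> \<Lambda> v" if "\<And>x. 0 \<le> v x"
      by (rule tendsto_lowerbound[OF lim _ \<Psi>(1)], intro ev always_eventually allI)
        (simp add: L v real_avg_nonneg that)
    assume w: "continuous_on UNIV w"
    show "\<Lambda> (\<lambda>x. v x + w x) = \<Lambda> v + \<Lambda> w"
    proof (rule tendsto_unique[OF \<Psi>(1) lim])
      have "\<forall>\<^sub>F M in \<Psi>. M v + M w = M (\<lambda>x. v x + w x)"
        by (intro ev always_eventually allI)
          (simp add: L v w continuous_on_add real_avg_linear(1)[OF K(1) v w])
      then show "((\<lambda>M. M (\<lambda>x. v x + w x)) \<longlongrightarrow> \<Lambda> v + \<Lambda> w) \<Psi>"
        by (rule Lim_transform_eventually[rotated]) (intro tendsto_intros lim)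
    qed
  next
    have "\<forall>\<^sub>F M in \<Psi>. 1 = M (\<lambda>_. 1)"
      by (intro ev always_eventually allI) (simp add: L real_avg_one K)
    then have "((\<lambda>M. M (\<lambda>_. 1)) \<longlongrightarrow> 1) \<Psi>"
      by (rule Lim_transform_eventually[rotated]) (rule tendsto_const)
    then show "\<Lambda> (\<lambda>_. 1) = 1"
      by (rule tendsto_unique[OF \<Psi>(1) lim])
  qed
  have inv: "\<Lambda> (\<lambda>x. v (T h x)) = \<Lambda> v" if v: "continuous_on UNIV v" for v h
  proof -
    have vT: "continuous_on UNIV (\<lambda>x. v (T h x))"
      by (rule continuous_orbit(3)[OF v])
    obtain B where B: "\<And>x. norm (v x) \<le> B"
      using compact_UNIV_bounded[OF compact_X v] by blast
    \<comment> \<open>The Folner condition enters here, as the vanishing of the error bound from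
      \<open>real_avg_translate\<close>.\<close>
    have "((\<lambda>i. B * (measure m (sym_diff ((\<lambda>x. h + x) ` F i) (F i)) / measure m (F i))) \<longlongrightarrow> 0) \<Phi>"
      using tendsto_mult_right_zero[OF folner] .
    then have "((\<lambda>i. L i (\<lambda>x. v (T h x)) - L i v) \<longlongrightarrow> 0) \<Phi>"
      by (rule Lim_null_comparison[rotated])
        (use real_avg_translate[OF K v] B in \<open>auto simp: L v vT intro!: always_eventually\<close>)
    then have "((\<lambda>M. M (\<lambda>x. v (T h x)) - M v) \<longlongrightarrow> 0) \<Psi>"
      by (intro tendsto_mono[OF \<Psi>(2)]) (simp add: filterlim_filtermap)
    from tendsto_unique[OF \<Psi>(1) tendsto_diff[OF lim lim] this] show ?thesis
      by simp
  qed
  \<comment> \<open>Invariance of the functional passes to the measure because continuous functions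
    determine it.\<close>
  have "distr repr borel (T h) = repr" for h
  proof (rule measure_eqI_continuous[OF compact_X metrizable_X])
    show "prob_space (distr repr borel (T h))"
      by (rule prob_space.prob_space_distr[OF prob_space_repr])
        (simp add: measurable_cong_sets[OF sets_repr refl] measurable_T)
    show "(LINT x|distr repr borel (T h). v x) = (LINT x|repr. v x)"
      if v: "continuous_on UNIV v" for v :: "'x \<Rightarrow> real"
      using integral_distr_T[OF sets_repr v, of h] integral_repr[OF v]
        integral_repr[OF continuous_orbit(3)[OF v]] inv[OF v] by simp
  qed (auto simp: prob_space_repr sets_repr)
  then have "repr \<in> invariant_prob_measures T"
    by (simp add: invariant_prob_measures_def prob_space_repr sets_repr)
  moreover have "e \<le> \<bar>\<Lambda> u - c\<bar>"
  proof (rule tendsto_lowerbound[OF _ _ \<Psi>(1)])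
    show "((\<lambda>M. \<bar>M u - c\<bar>) \<longlongrightarrow> \<bar>\<Lambda> u - c\<bar>) \<Psi>"
      by (intro tendsto_intros lim)
    show "\<forall>\<^sub>F M in \<Psi>. e \<le> \<bar>M u - c\<bar>"
      using far by (intro ev) (simp add: L[OF u])
  qed
  ultimately show ?thesis
    unfolding integral_repr[OF u, symmetric] by (rule bexI[rotated])
qed

lemma uniform_convergence:
  assumes F: "folner_net m (F :: 'i::directed_preorder \<Rightarrow> 'g set)"
    and unique: "\<And>\<nu>. \<nu> \<in> invariant_prob_measures T \<Longrightarrow> \<nu> = \<mu>"
    and u: "continuous_on UNIV u" and e: "0 < e"
  shows "\<forall>\<^sub>F i in net_filter. \<forall>x. \<bar>real_avg m T (F i) u x - (LINT x|\<mu>. u x)\<bar> < e"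
proof (rule ccontr)
  define P where "P i \<longleftrightarrow> (\<exists>x. e \<le> \<bar>real_avg m T (F i) u x - (LINT x|\<mu>. u x)\<bar>)" for i
  \<comment> \<open>The indices at which uniformity fails are frequent, so restricting
    \<open>net_filter\<close> to them gives a proper filter.\<close>
  define \<Phi> where "\<Phi> = inf net_filter (principal {i. P i})"
  assume "\<not> ?thesis"
  then have "\<not> (\<forall>\<^sub>F i in net_filter. \<not> P i)"
    by (simp add: P_def not_le)
  then have "\<Phi> \<noteq> bot"
    unfolding \<Phi>_def by (auto simp: trivial_limit_def eventually_inf_principal)
  have "\<forall>i. \<exists>x. P i \<longrightarrow> e \<le> \<bar>real_avg m T (F i) u x - (LINT x|\<mu>. u x)\<bar>"
    by (auto simp: P_def)
  then obtain x where x: "\<And>i. P i \<Longrightarrow> e \<le> \<bar>real_avg m T (F i) u (x i) - (LINT x|\<mu>. u x)\<bar>"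
    by metis
  have far: "\<forall>\<^sub>F i in \<Phi>. e \<le> \<bar>real_avg m T (F i) u (x i) - (LINT x|\<mu>. u x)\<bar>"
    unfolding \<Phi>_def eventually_inf_principal by (intro always_eventually allI) (simp add: x)
  have "\<Phi> \<le> net_filter"
    unfolding \<Phi>_def by (rule inf_le1)
  then obtain \<nu> where "\<nu> \<in> invariant_prob_measures T" "e \<le> \<bar>(LINT x|\<nu>. u x) - (LINT x|\<mu>. u x)\<bar>"
    using ergodic_limit_measure[OF F \<open>\<Phi> \<noteq> bot\<close> _ u far] by blast
  then show False
    using unique e by auto
qed

text \<open>The averages converge uniformly, and a mean over any set deviates from a constant by at
  most the supremum of the deviation; hence the sets \<open>C i\<close> may vary freely.\<close>

lemma means_converge_if_uniquely_ergodic: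
  assumes F: "folner_net m (F :: 'i::directed_preorder \<Rightarrow> 'g set)"
    and \<mu>: "\<mu> \<in> invariant_prob_measures T" and ue: "uniquely_ergodic T"
  shows "means_of_averages_converge (sets borel) m T \<mu> F"
  unfolding means_of_averages_converge_def
proof (intro allI impI tendstoI)
  fix C :: "'i \<Rightarrow> 'x set" and f :: "'x \<Rightarrow> complex" and e :: real
  assume C: "\<forall>i. C i \<in> sets borel \<and> 0 < measure \<mu> (C i)" and f: "continuous_on UNIV f" and e: "0 < e"
  have K: "compact (F i)" "0 < measure m (F i)" for i
    using F by (auto simp: folner_net_def)
  have \<mu>': "prob_space \<mu>" "sets \<mu> = sets borel"
    using \<mu> by (auto simp: invariant_prob_measures_def)
  interpret prob_space \<mu> by fact
  have unique: "\<nu> = \<mu>" if "\<nu> \<in> invariant_prob_measures T" for \<nu>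
    using ue that \<mu> unfolding uniquely_ergodic_def by blast
  have int: "integrable \<mu> f"
    by (rule integrable_continuous_compact_UNIV[OF compact_X finite_measure_axioms \<mu>'(2) f])
  \<comment> \<open>Bounds \<open>e / 4\<close> for real and imaginary parts give
    \<open>e / 2\<close> for the modulus, which survives taking means and leaves a strict bound by
    \<open>e\<close>.\<close>
  have "\<forall>\<^sub>F i in net_filter. \<forall>x. \<bar>real_avg m T (F i) (\<lambda>x. Re (f x)) x - (LINT x|\<mu>. Re (f x))\<bar> < e / 4"
    by (rule uniform_convergence[OF F unique]) (use f e in \<open>auto intro!: continuous_intros\<close>)
  moreover have "\<forall>\<^sub>F i in net_filter. \<forall>x. \<bar>real_avg m T (F i) (\<lambda>x. Im (f x)) x - (LINT x|\<mu>. Im (f x))\<bar> < e / 4"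
    by (rule uniform_convergence[OF F unique]) (use f e in \<open>auto intro!: continuous_intros\<close>)
  ultimately show "\<forall>\<^sub>F i in net_filter. dist (mean_on \<mu> (C i) (Avg m T (F i) f)) (LINT x|\<mu>. f x) < e"
  proof eventually_elim
    case (elim i)
    have "norm (Avg m T (F i) f x - (LINT x|\<mu>. f x)) \<le> e / 2" for x
    proof -
      have "Re (Avg m T (F i) f x - (LINT x|\<mu>. f x)) =
          real_avg m T (F i) (\<lambda>x. Re (f x)) x - (LINT x|\<mu>. Re (f x))"
        "Im (Avg m T (F i) f x - (LINT x|\<mu>. f x)) =
          real_avg m T (F i) (\<lambda>x. Im (f x)) x - (LINT x|\<mu>. Im (f x))"
        unfolding integral_Re[OF int] integral_Im[OF int] Avg_eq[OF K(1) f] by simp_all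
      then have "norm (Avg m T (F i) f x - (LINT x|\<mu>. f x)) \<le>
          \<bar>real_avg m T (F i) (\<lambda>x. Re (f x)) x - (LINT x|\<mu>. Re (f x))\<bar> +
          \<bar>real_avg m T (F i) (\<lambda>x. Im (f x)) x - (LINT x|\<mu>. Im (f x))\<bar>"
        using cmod_le[of "Avg m T (F i) f x - (LINT x|\<mu>. f x)"] by (simp only:)
      also have "\<dots> \<le> e / 2"
        using elim(1)[rule_format, of x] elim(2)[rule_format, of x] by simp
      finally show ?thesis .
    qed
    then have "norm (mean_on \<mu> (C i) (Avg m T (F i) f) - (LINT x|\<mu>. f x)) \<le> e / 2"
      using C by (intro mean_on_dist_le[OF compact_X \<mu>'] continuous_Avg K f) auto
    then show ?case
      using e by (simp add: dist_norm)
  qed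
qed

section \<open>From means over open sets back to unique ergodicity\<close>

text \<open>The sets in the hypothesis may depend on the index, so they can be placed where the
  averages are large; this bounds the limit of the means from below.\<close>

lemma integral_le_if_means_converge:
  assumes F: "folner_net m (F :: 'i::directed_preorder \<Rightarrow> 'g set)"
    and \<mu>: "\<mu> \<in> invariant_prob_measures T" and \<nu>: "\<nu> \<in> invariant_prob_measures T"
    and supp: "fully_supported \<mu>"
    and conv: "means_of_averages_converge {U. open U} m T \<mu> F"
    and u: "continuous_on UNIV u"
  shows "(LINT x|\<nu>. u x) \<le> (LINT x|\<mu>. u x :: real)"
proof (rule field_le_epsilon)
  fix e :: real assume e: "0 < e"
  let ?c = "(LINT x|\<nu>. u x) - e"
  have K: "compact (F i)" "0 < measure m (F i)" for i
    using F by (auto simp: folner_net_def)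
  have \<mu>': "prob_space \<mu>" "sets \<mu> = sets borel"
    using \<mu> by (auto simp: invariant_prob_measures_def)
  \<comment> \<open>Continuity of the average makes \<open>U i\<close> open,
    \<open>ex_real_avg_gt\<close> makes it nonempty, and full support then gives it positive
    \<mu>-measure.\<close>
  define U where "U i = {x. ?c < real_avg m T (F i) u x}" for i
  have U: "open (U i)" "0 < measure \<mu> (U i)" for i
  proof -
    show "open (U i)"
      unfolding U_def by (intro open_Collect_less continuous_intros continuous_real_avg K u)
    moreover have "U i \<noteq> {}"
      using ex_real_avg_gt[OF K u \<nu> e] by (auto simp: U_def)
    ultimately show "0 < measure \<mu> (U i)"
      using supp by (simp add: fully_supported_def)
  qed
  \<comment> \<open>The convergence hypothesis concerns complex functions; real parts of the limit
    recover the integral of \<open>u\<close>.\<close>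
  define f where "f x = complex_of_real (u x)" for x
  have f: "continuous_on UNIV f"
    unfolding f_def by (intro continuous_intros u)
  have "((\<lambda>i. mean_on \<mu> (U i) (Avg m T (F i) f)) \<longlongrightarrow> (LINT x|\<mu>. f x)) net_filter"
    using conv U f by (simp add: means_of_averages_converge_def)
  then have "((\<lambda>i. Re (mean_on \<mu> (U i) (Avg m T (F i) f))) \<longlongrightarrow> (LINT x|\<mu>. u x)) net_filter"
    using tendsto_Re by (fastforce simp: f_def)
  then have "?c \<le> (LINT x|\<mu>. u x)"
  proof (rule tendsto_lowerbound[OF _ always_eventually net_filter_neq_bot], intro allI)
    fix i
    show "?c \<le> Re (mean_on \<mu> (U i) (Avg m T (F i) f))"
    proof (rule Re_mean_on_ge[OF compact_X \<mu>'])
      show "?c \<le> Re (Avg m T (F i) f x)" if "x \<in> U i" for x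
        using that by (simp add: Avg_eq[OF K(1) f] U_def f_def)
    qed (use U f K in \<open>auto intro: continuous_Avg\<close>)
  qed
  then show "(LINT x|\<nu>. u x) \<le> (LINT x|\<mu>. u x) + e"
    by simp
qed

text \<open>Existence is witnessed by \<open>\<mu>\<close>. For uniqueness, the one-sided inequality
  for \<open>u\<close> and \<open>-u\<close> gives equal integrals of continuous functions, which
  determine the measure.\<close>

lemma uniquely_ergodic_if_means_converge:
  assumes F: "folner_net m (F :: 'i::directed_preorder \<Rightarrow> 'g set)"
    and \<mu>: "\<mu> \<in> invariant_prob_measures T" and supp: "fully_supported \<mu>"
    and conv: "means_of_averages_converge {U. open U} m T \<mu> F"
  shows "uniquely_ergodic T"
  unfolding uniquely_ergodic_def
proof (rule ex1I)
  show "\<mu> \<in> invariant_prob_measures T"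
    by (rule \<mu>)
  fix \<nu> assume \<nu>: "\<nu> \<in> invariant_prob_measures T"
  have prob: "prob_space \<mu>" "sets \<mu> = sets borel" "prob_space \<nu>" "sets \<nu> = sets borel"
    using \<mu> \<nu> by (simp_all add: invariant_prob_measures_def)
  have "(LINT x|\<nu>. u x) = (LINT x|\<mu>. u x)" if u: "continuous_on UNIV u" for u :: "'x \<Rightarrow> real"
  proof (rule antisym)
    show "(LINT x|\<nu>. u x) \<le> (LINT x|\<mu>. u x)"
      by (rule integral_le_if_means_converge[OF F \<mu> \<nu> supp conv u])
    have "(LINT x|\<nu>. - u x) \<le> (LINT x|\<mu>. - u x)"
      by (rule integral_le_if_means_converge[OF F \<mu> \<nu> supp conv continuous_on_minus[OF u]])
    then show "(LINT x|\<mu>. u x) \<le> (LINT x|\<nu>. u x)"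
      by simp
  qed
  then show "\<nu> = \<mu>"
    by (rule measure_eqI_continuous[OF compact_X metrizable_X prob(3,4,1,2)])
qed

end

theorem theorem1p14:
  fixes m :: "'g::{topological_group_add, t2_space} measure"
    and T :: "'g \<Rightarrow> 'x::topological_space \<Rightarrow> 'x"
    and \<mu> :: "'x measure"
    and F :: "'i::directed_preorder \<Rightarrow> 'g set"
  assumes "locally_compact_space (euclidean :: 'g topology)"
    and "unimodular_group TYPE('g)"
    and "amenable_group TYPE('g)"
    and "bi_invariant_haar_measure m"
    and "compact (UNIV :: 'x set)"
    and "metrizable_space (euclidean :: 'x topology)"
    and "continuous_action T"
    and "\<mu> \<in> invariant_prob_measures T"
    and "folner_net m F"
  shows "(uniquely_ergodic T \<longrightarrow> means_of_averages_converge (sets borel) m T \<mu> F) \<and>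
    (means_of_averages_converge (sets borel) m T \<mu> F \<longrightarrow>
       means_of_averages_converge {U. open U} m T \<mu> F) \<and>
    (fully_supported \<mu> \<longrightarrow> means_of_averages_converge {U. open U} m T \<mu> F \<longrightarrow>
       uniquely_ergodic T)"
proof -
  interpret compact_action m T
    using assms by unfold_locales
  show ?thesis
  proof (intro conjI impI)
    show "means_of_averages_converge (sets borel) m T \<mu> F" if "uniquely_ergodic T"
      by (rule means_converge_if_uniquely_ergodic[OF assms(9,8) that])
    show "means_of_averages_converge {U. open U} m T \<mu> F"
      if "means_of_averages_converge (sets borel) m T \<mu> F"
      by (rule means_of_averages_converge_mono[OF _ that]) auto
    show "uniquely_ergodic T"
      if "fully_supported \<mu>" "means_of_averages_converge {U. open U} m T \<mu> F"
      by (rule uniquely_ergodic_if_means_converge[OF assms(9,8) that])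
  qed
qed

end
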